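(* Let $n\ge 4$ be an integer. Among all connected $4$-chromatic planar graphs of order $n$, the kite graph $K_4^{(n)}$ is the unique graph (up to isomorphism) maximizing the distance spectral radius. That is, $K_4^{(n)}$ is a connected $4$-chromatic planar graph of order $n$, and for every connected $4$-chromatic planar graph $G$ of order $n$ with $G\not\cong K_4^{(n)}$ one has $\rho(G)<\rho(K_4^{(n)})$.
   Context: All graphs are finite, simple and undirected. For a connected graph $G$ with vertices $v_1,\dots,v_n$, the distance matrix $D(G)$ is the $n\times n$ symmetric matrix with $(i,j)$ entry $d_G(v_i,v_j)$, the length (number of edges) of a shortest path between $v_i$ and $v_j$. The distance spectral radius $\rho(G)$ is the largest eigenvalue of $D(G)$. A graph $G$ is $k$-chromatic if its chromatic number is $\chi(G)=k$. For $n\ge 4$, the kite graph $K_4^{(n)}$ is the graph of order $n$ obtained from the complete graph $K_4$ by attaching a path of length $n-4$ at one vertex $v$ of $K_4$ (the path has $v$ as an end-vertex and has no other vertex in common with $K_4$). *)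

theory Defs
  imports
    "HOL-Analysis.Path_Connected"
    "Graph_Theory.Graph_Theory"
    "Jordan_Normal_Form.Char_Poly"
begin

text \<open>
  A finite simple undirected graph is a \<open>pair_graph\<close> of the AFP entry Graph_Theory: a finite
  vertex set with a finite, symmetric, loop-free set of ordered pairs, the undirected edge
  \<open>{u, v}\<close> being represented by the two arcs \<open>(u, v)\<close> and \<open>(v, u)\<close>.
\<close>

text \<open>Meaningful when \<open>u\<close> and \<open>v\<close> are joined by a path, hence always in a connected graph.\<close>

definition graph_dist :: "'a pair_pre_digraph \<Rightarrow> 'a \<Rightarrow> 'a \<Rightarrow> nat" where
  "graph_dist G u v = (LEAST k. \<exists>p. pre_digraph.apath (with_proj G) u p v \<and> length p = k)"

text \<open>The list \<open>vs\<close> is the enumeration \<open>v\<^sub>1, \<dots>, v\<^sub>n\<close> of the vertices.\<close>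

definition distance_matrix :: "'a pair_pre_digraph \<Rightarrow> 'a list \<Rightarrow> real mat" where
  "distance_matrix G vs =
     Matrix.mat (length vs) (length vs) (\<lambda>(i, j). real (graph_dist G (vs ! i) (vs ! j)))"

text \<open>
  Two enumerations of the vertices give permutation-similar matrices, so the arbitrary choice
  made here does not affect the value.
\<close>

definition distance_spectral_radius :: "'a pair_pre_digraph \<Rightarrow> real" where
  "distance_spectral_radius G =
     Max {k. eigenvalue (distance_matrix G (SOME vs. distinct vs \<and> set vs = pverts G)) k}"

definition colorable :: "'a pair_pre_digraph \<Rightarrow> nat \<Rightarrow> bool" where
  "colorable G k \<longleftrightarrow>
     (\<exists>c :: 'a \<Rightarrow> nat. (\<forall>v\<in>pverts G. c v < k) \<and> (\<forall>(u, v)\<in>parcs G. c u \<noteq> c v))"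

definition chromatic_number :: "'a pair_pre_digraph \<Rightarrow> nat" where
  "chromatic_number G = (LEAST k. colorable G k)"

text \<open>
  A drawing in the plane (the complex numbers): \<open>p\<close> places the vertices, and \<open>g {u, v}\<close>
  parametrises the arc drawn for the edge \<open>{u, v}\<close>, in either direction. By the last two
  conditions, the interior of an arc contains no vertex and no point of another arc.
\<close>

definition plane_drawing ::
    "'a pair_pre_digraph \<Rightarrow> ('a \<Rightarrow> complex) \<Rightarrow> ('a set \<Rightarrow> real \<Rightarrow> complex) \<Rightarrow> bool" where
  "plane_drawing G p g \<longleftrightarrow>
     inj_on p (pverts G) \<and>
     (\<forall>(u, v)\<in>parcs G.
        arc (g {u, v}) \<and>
        {pathstart (g {u, v}), pathfinish (g {u, v})} = {p u, p v} \<and>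
        path_image (g {u, v}) \<inter> p ` pverts G = {p u, p v}) \<and>
     (\<forall>(u, v)\<in>parcs G. \<forall>(x, y)\<in>parcs G. {u, v} \<noteq> {x, y} \<longrightarrow>
        path_image (g {u, v}) \<inter> path_image (g {x, y}) \<subseteq> p ` pverts G)"

definition planar :: "'a pair_pre_digraph \<Rightarrow> bool" where
  "planar G \<longleftrightarrow> (\<exists>p g. plane_drawing G p g)"

text \<open>
  For \<open>n \<ge> 4\<close>: the complete graph on \<open>{0, 1, 2, 3}\<close> with the path \<open>3, 4, \<dots>, n - 1\<close>
  attached at the vertex \<open>3\<close>.
\<close>

definition kite :: "nat \<Rightarrow> nat pair_pre_digraph" where
  "kite n =
     \<lparr> pverts = {0..<n},
       parcs = {(i, j). i < n \<and> j < n \<and> i \<noteq> j \<and>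
                        (i < 4 \<and> j < 4 \<or> j = Suc i \<or> i = Suc j)} \<rparr>"

definition connected_4chromatic_planar :: "nat \<Rightarrow> 'a pair_pre_digraph \<Rightarrow> bool" where
  "connected_4chromatic_planar n G \<longleftrightarrow>
     pair_graph G \<and> card (pverts G) = n \<and> Digraph_Component.connected (with_proj G) \<and>
     chromatic_number G = 4 \<and> planar G"

end

theory Submission imports Defs "HOL-Analysis.Function_Topology"
begin

text \<open>
  Planarity of the competitors plays no role: every connected graph \<open>G\<close> that is not 3-colourable is
  dominated by the kite. For positive weights \<open>x\<close> on the vertices, the value of the quadratic form of
  the distance matrix of \<open>G\<close> is bounded by that of the kite form for a suitable placement of the
  weights on the kite, strictly unless \<open>G\<close> is a kite. Taking for \<open>x\<close> the Perron vector of \<open>G\<close>, the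
  Rayleigh principle yields the theorem.

  The placement is built from a minimal non-3-colourable set \<open>S\<close> of \<open>m\<close> vertices. Minimum degree three
  and 2-connectedness force at most \<open>m - 2k\<close> vertices of \<open>S\<close> to be at distance at least \<open>k \<ge> 2\<close> from
  a given one; placing the sorted weights alternately at the two ends of the kite then wins, by
  summation by parts. The other vertices are added one by one, each adjacent to an earlier one: the
  weight of the new vertex is first merged into its neighbour and then split off again by one of a
  few rearrangements of the kite.
\<close>

text \<open>Deleting vertices can disconnect \<open>G\<close> and can lengthen the distances inside
  what remains. This is why \<open>kite_dominated\<close> speaks of an arbitrary function
  \<open>d\<close> on a set: at every stage \<open>d\<close> is the distance of the whole graph
  \<open>G\<close>, only restricted, and the set grows along arcs of \<open>G\<close>. Merging
  \<open>v\<close> into its neighbour \<open>u\<close> works because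
  \<open>d v w <= d u w + 1\<close>: the worst case is a pendant vertex, and for it the change of
  the form is explicit. For the minimal set \<open>S\<close> only counts of far vertices are
  available. The cap \<open>m - 2 * k\<close> comes from \<open>u\<close> and three neighbours,
  which are four vertices at distance below 2, and from two vertices on each further sphere with a
  vertex of \<open>S\<close> beyond it. Such counts bound row sums, not single distances; sorting
  the weights makes row sums over leading blocks sufficient. For five or more vertices the seed is
  strictly dominated, so equality can only start from a complete graph on four vertices, and it has
  to be traced through every insertion to identify \<open>G\<close>. The order of the kite may
  depend on the weights, since in the end a single weight vector is used.\<close>

section \<open>The distance form of the kite\<close>

text \<open>The truncated subtraction identifies the vertices \<open>0, 1, 2\<close>, whose mutual distances are \<open>1\<close>.\<close>

definition kite_dist :: "nat \<Rightarrow> nat \<Rightarrow> nat" where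
  "kite_dist i j = (if i = j then 0 else max 1 ((i - 2 - (j - 2)) + (j - 2 - (i - 2))))"

lemma kite_dist_commute: "kite_dist i j = kite_dist j i"
  by (simp add: kite_dist_def add.commute)

lemma kite_dist_self [simp]: "kite_dist i i = 0"
  by (simp add: kite_dist_def)

lemma kite_dist_ge_one: "i \<noteq> j \<Longrightarrow> 1 \<le> kite_dist i j"
  by (simp add: kite_dist_def)

lemma kite_dist_Suc_right: "i \<le> n \<Longrightarrow> 3 \<le> n \<Longrightarrow> kite_dist i (Suc n) = Suc (kite_dist i n)"
  by (auto simp: kite_dist_def max_def)

definition kite_form :: "real list \<Rightarrow> real" where
  "kite_form ws = (\<Sum>i<length ws. \<Sum>j<length ws. real (kite_dist i j) * ws ! i * ws ! j)"

text \<open>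
  \<open>cut_sum s ys\<close> adds, over the edges of a path whose vertices have weights \<open>ys\<close> and which hangs at
  a part of weight \<open>s\<close>, the product of the weights of the two sides of the edge.
\<close>

fun cut_sum :: "real \<Rightarrow> real list \<Rightarrow> real" where
  "cut_sum s [] = 0"
| "cut_sum s (y # ys) = s * (y + sum_list ys) + cut_sum (s + y) ys"

text \<open>The weighted sum of the distances to one more vertex appended to the path: each edge,
  the new one included, contributes the weight that it separates from that vertex.\<close>

fun end_moment :: "real \<Rightarrow> real list \<Rightarrow> real" where
  "end_moment s [] = s"
| "end_moment s (y # ys) = s + end_moment (s + y) ys"

lemma cut_sum_snoc: "cut_sum s (ys @ [y]) = cut_sum s ys + y * end_moment s ys"
  by (induction ys arbitrary: s) (auto simp: algebra_simps)

lemma end_moment_snoc: "end_moment s (ys @ [y]) = end_moment s ys + s + sum_list ys + y"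
  by (induction ys arbitrary: s) (auto simp: algebra_simps)

lemma kite_form_snoc:
  "kite_form (ws @ [y]) =
     kite_form ws + 2 * y * (\<Sum>i<length ws. real (kite_dist i (length ws)) * ws ! i)"
proof -
  let ?n = "length ws"
  have *: "(\<Sum>i<?n. real (kite_dist i ?n) * ws ! i * y) =
      y * (\<Sum>i<?n. real (kite_dist i ?n) * ws ! i)"
    by (simp add: sum_distrib_left mult_ac)
  have **: "(\<Sum>j<?n. real (kite_dist ?n j) * y * ws ! j) =
      y * (\<Sum>i<?n. real (kite_dist i ?n) * ws ! i)"
    by (simp add: sum_distrib_left mult_ac kite_dist_commute[of ?n])
  show ?thesis
    by (simp add: kite_form_def nth_append sum.distrib * **)
qed

lemma end_moment_eq_sum:
  "(\<Sum>i<length ys + 3. real (kite_dist i (length ys + 3)) * (a # b # c # ys) ! i) =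
     end_moment (a + b + c) ys"
proof (induction ys rule: rev_induct)
  case Nil
  show ?case by (simp add: kite_dist_def numeral_3_eq_3)
next
  case (snoc y ys)
  let ?n = "length ys + 3"
  let ?w = "a # b # c # ys"
  have n: "?n = length ?w" by simp
  have sum_w: "(\<Sum>i<?n. ?w ! i) = sum_list ?w"
    unfolding n by (simp only: sum_list_sum_nth atLeast0LessThan)
  have "(\<Sum>i<length (ys @ [y]) + 3. real (kite_dist i (length (ys @ [y]) + 3)) * (a # b # c # ys @ [y]) ! i)
     = (\<Sum>i<Suc ?n. real (Suc (kite_dist i ?n)) * (?w @ [y]) ! i)"
    using kite_dist_Suc_right[of _ ?n] by (intro sum.cong) auto
  also have "\<dots> = (\<Sum>i<?n. real (Suc (kite_dist i ?n)) * ?w ! i) + y"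
    by (simp add: nth_append[of ?w] n del: append_Cons of_nat_Suc)
  also have "\<dots> = (\<Sum>i<?n. real (kite_dist i ?n) * ?w ! i) + (\<Sum>i<?n. ?w ! i) + y"
    by (simp add: algebra_simps sum.distrib)
  also have "\<dots> = end_moment (a + b + c) (ys @ [y])"
    unfolding snoc.IH sum_w by (simp add: end_moment_snoc)
  finally show ?case .
qed

text \<open>The positions 0, 1, 2 have equal distances to every later position, so seen from the
  path they are one part of weight \<open>a + b + c\<close>, and the rest is a path whose edges all
  separate two sides. The three products account for the mutual distances 1, the factor 2 for
  ordered pairs.\<close>

lemma kite_form_eq_cut_sum:
  "kite_form (a # b # c # ys) = 2 * (a * b + b * c + c * a + cut_sum (a + b + c) ys)"
proof (induction ys rule: rev_induct)
  case Nil
  show ?case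
    by (simp add: kite_form_def kite_dist_def numeral_3_eq_3 algebra_simps)
next
  case (snoc y ys)
  have "kite_form (a # b # c # ys @ [y]) =
      kite_form (a # b # c # ys) + 2 * y * end_moment (a + b + c) ys"
    using kite_form_snoc[of "a # b # c # ys" y] end_moment_eq_sum[of ys a b c]
    by (simp only: append_Cons list.size add_Suc_right add_0_right numeral_3_eq_3)
  then show ?case
    by (simp add: snoc.IH cut_sum_snoc algebra_simps)
qed

section \<open>Splitting and reversing a path\<close>

lemma cut_sum_append_diff:
  assumes "sum_list ys = sum_list zs"
  shows "cut_sum s (us @ ys) - cut_sum s (us @ zs) =
    cut_sum (s + sum_list us) ys - cut_sum (s + sum_list us) zs"
proof (induction us arbitrary: s)
  case (Cons u us)
  show ?case using Cons.IH[of "s + u"] by (simp add: assms add.assoc)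
qed simp

lemma cut_sum_split_last:
  "cut_sum s (us @ [p, q]) = cut_sum s (us @ [p + q]) + (s + sum_list us + p) * q"
  by (induction us arbitrary: s) (auto simp: algebra_simps)

text \<open>
  Reversing the part of the path beyond a heavy vertex of weight \<open>w\<close>: every edge of the path that
  cuts off weight \<open>t\<close> now cuts off \<open>s + t\<close>.
\<close>

lemma cut_sum_rev_ge:
  assumes "0 \<le> s" "vs \<noteq> []" "\<forall>v\<in>set vs. 0 \<le> v" "sum_list vs \<le> w"
  shows "cut_sum (s + w) vs + 2 * s * w \<le> cut_sum s (rev vs @ [w])"
  using assms(2-4)
proof (induction vs arbitrary: w)
  case (Cons v vs)
  have 0: "0 \<le> sum_list vs" "0 \<le> v"
    using Cons.prems(2) by (auto intro: sum_list_nonneg)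
  \<comment> \<open>In both orders \<open>v\<close> is next to \<open>w\<close>, and the induction
    lumps them into one vertex of weight \<open>v + w\<close>. With \<open>B\<close> the sum of the
    list, the surplus \<open>2 * s * w\<close> is \<open>s * (w + B)\<close> from the edge at the
    part of weight \<open>s\<close> plus \<open>s * (w - B)\<close> from the edge at
    \<open>w\<close>.\<close>
  have eq: "cut_sum s (rev (v # vs) @ [w]) =
      cut_sum s (rev vs @ [v + w]) + (s + sum_list vs + v) * w"
    using cut_sum_split_last[of s "rev vs" v w] by (simp add: sum_list_rev)
  show ?case
  proof (cases "vs = []")
    case True
    then show ?thesis by (simp add: algebra_simps)
  next
    case False
    then have "cut_sum (s + (v + w)) vs + 2 * s * (v + w) \<le> cut_sum s (rev vs @ [v + w])"
      using Cons.prems 0 by (intro Cons.IH) auto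
    moreover have "0 \<le> s * (w + 2 * v - (v + sum_list vs))"
      using Cons.prems 0 assms(1) by (intro mult_nonneg_nonneg) auto
    moreover have "cut_sum (s + w) (v # vs) = (s + w) * (v + sum_list vs) + cut_sum (s + (v + w)) vs"
      by (simp add: add_ac)
    ultimately show ?thesis
      unfolding eq by (simp add: algebra_simps)
  qed
qed simp

text \<open>The same reversal, now of \<open>vs @ [l]\<close>, but the edge at \<open>l\<close>
  keeps its surplus \<open>s * (w + sum_list vs - l)\<close> on top of \<open>2 * s * w\<close>.
  This is needed when \<open>l\<close> becomes a triangle vertex: the first term of the reversed cut
  sum then shrinks to \<open>s * l\<close>, and \<open>2 * s * w\<close> alone would not make up for
  it.\<close>

lemma cut_sum_rev_ge_last:
  assumes "0 \<le> s" "vs \<noteq> []" "\<forall>v\<in>set vs. 0 \<le> v" "0 \<le> l" "sum_list vs + l \<le> w"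
  shows "cut_sum (s + w) (vs @ [l]) + s * (3 * w + sum_list vs - l) \<le> cut_sum s (l # rev vs @ [w])"
  using assms(2,3,5)
proof (induction vs arbitrary: w)
  case (Cons v vs)
  have 0: "0 \<le> sum_list vs" "0 \<le> v"
    using Cons.prems(2) by (auto intro: sum_list_nonneg)
  have eq: "cut_sum s (l # rev (v # vs) @ [w]) =
      cut_sum s (l # rev vs @ [v + w]) + (s + l + sum_list vs + v) * w"
    using cut_sum_split_last[of s "l # rev vs" v w] by (simp add: sum_list_rev add_ac)
  show ?case
  proof (cases "vs = []")
    case True
    then show ?thesis by (simp add: algebra_simps)
  next
    case False
    then have "cut_sum (s + (v + w)) (vs @ [l]) + s * (3 * (v + w) + sum_list vs - l)
        \<le> cut_sum s (l # rev vs @ [v + w])"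
      using Cons.prems 0 by (intro Cons.IH) auto
    moreover have "0 \<le> s * (w + v - sum_list vs - l)"
      using Cons.prems 0 assms(1) by (intro mult_nonneg_nonneg) auto
    moreover have "cut_sum (s + w) ((v # vs) @ [l]) =
        (s + w) * (v + sum_list vs + l) + cut_sum (s + (v + w)) (vs @ [l])"
      by (simp add: add_ac)
    ultimately show ?thesis
      unfolding eq by (simp add: algebra_simps)
  qed
qed simp

section \<open>A pendant vertex absorbed by rearranging the kite\<close>

text \<open>Here \<open>f\<close> is the value with a pendant vertex of weight \<open>z\<close> at
  the path vertex of weight \<open>q\<close>. Let \<open>A\<close> be the weight before that vertex
  and \<open>B\<close> the weight behind it. Putting \<open>z\<close> in front of \<open>q\<close>
  replaces the cut \<open>z * (A + q + B)\<close> by \<open>(A + z) * (q + B)\<close>, a gain of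
  \<open>A * (q + B - z)\<close>. If \<open>z\<close> is at least \<open>q + B\<close>, the merged
  vertex outweighs what lies behind it, so turning that part round gains, and \<open>z\<close> then
  hangs at the end.\<close>

lemma kite_form_pendant_path:
  assumes pos: "0 < a" "0 < b" "0 < c" "\<forall>y\<in>set (us @ vs). 0 < y" "0 < q" "0 < z" and "vs \<noteq> []"
  defines "f \<equiv> kite_form (a # b # c # us @ (q + z) # vs) + 2 * z * (a + b + c + sum_list us + q + sum_list vs)"
  shows "f < kite_form (a # b # c # us @ z # q # vs) \<or>
    f < kite_form (a # b # c # us @ rev vs @ [q, z])"
proof -
  define A B where "A = a + b + c + sum_list us" and "B = sum_list vs"
  have "0 \<le> sum_list us" "0 \<le> B"
    using pos unfolding B_def by (auto intro!: sum_list_nonneg simp: less_imp_le)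
  then have A: "0 < A" using pos by (simp add: A_def)
  have f: "f = 2 * (a * b + b * c + c * a + cut_sum (a + b + c) (us @ (q + z) # vs) + z * (A + q + B))"
    by (simp add: f_def kite_form_eq_cut_sum A_def B_def algebra_simps)
  show ?thesis
  proof (cases "z < q + B")
    case True
    have "cut_sum (a + b + c) (us @ z # q # vs) - cut_sum (a + b + c) (us @ (q + z) # vs)
        = cut_sum A (z # q # vs) - cut_sum A ((q + z) # vs)"
      unfolding A_def by (intro cut_sum_append_diff) simp
    also have "\<dots> = (A + z) * (q + B)"
      by (simp add: B_def algebra_simps)
    finally have *: "cut_sum (a + b + c) (us @ z # q # vs) - cut_sum (a + b + c) (us @ (q + z) # vs)
      = (A + z) * (q + B)" .
    have "0 < A * (q + B - z)" using A True by simp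
    then have "z * (A + q + B) < (A + z) * (q + B)" by (simp add: algebra_simps)
    with * show ?thesis by (simp add: f kite_form_eq_cut_sum)
  next
    case False
    have "cut_sum (a + b + c) (us @ rev vs @ [q, z]) - cut_sum (a + b + c) (us @ (q + z) # vs)
        = cut_sum A (rev vs @ [q, z]) - cut_sum A ((q + z) # vs)"
      unfolding A_def by (intro cut_sum_append_diff) (simp add: sum_list_rev)
    moreover have "cut_sum A (rev vs @ [q, z]) = cut_sum A (rev vs @ [q + z]) + (A + B + q) * z"
      by (simp add: cut_sum_split_last sum_list_rev B_def)
    moreover have "cut_sum (A + (q + z)) vs + 2 * A * (q + z) \<le> cut_sum A (rev vs @ [q + z])"
      using False pos A \<open>vs \<noteq> []\<close> by (intro cut_sum_rev_ge) (auto simp: B_def less_imp_le)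
    moreover have "cut_sum A ((q + z) # vs) = A * (q + z + B) + cut_sum (A + (q + z)) vs"
      by (simp add: B_def)
    moreover have "0 < A * (q + z - B)" using A False pos by simp
    ultimately have "z * (A + q + B) <
        cut_sum (a + b + c) (us @ rev vs @ [q, z]) - cut_sum (a + b + c) (us @ (q + z) # vs)"
      by (simp add: B_def[symmetric] algebra_simps)
    then show ?thesis by (simp add: f kite_form_eq_cut_sum)
  qed
qed

lemma kite_form_pendant_last:
  "kite_form (a # b # c # us @ [q + z]) + 2 * z * (a + b + c + sum_list us + q) =
     kite_form (a # b # c # us @ [q, z])"
  by (simp add: kite_form_eq_cut_sum cut_sum_split_last algebra_simps)

text \<open>The options parallel those on the path. Either \<open>q\<close> moves out onto the path
  and leaves its triangle place to \<open>z\<close>, which gains as long as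
  \<open>z < sum_list ys + l\<close>; or the path is turned round, its last vertex \<open>l\<close>
  enters the triangle, and \<open>q\<close>, \<open>z\<close> form the new end.\<close>

lemma kite_form_pendant_triangle:
  assumes pos: "0 < a" "0 < b" "\<forall>y\<in>set ys. 0 < y" "0 < q" "0 < z" "0 < l" and "ys \<noteq> []"
  defines "f \<equiv> kite_form (a # b # (q + z) # ys @ [l]) + 2 * z * (a + b + q + sum_list ys + l)"
  shows "f < kite_form (a # b # z # q # ys @ [l]) \<or> f < kite_form (a # b # l # rev ys @ [q, z])"
proof -
  define s B where "s = a + b" and "B = sum_list ys"
  have B: "0 \<le> B"
    using pos unfolding B_def by (auto intro!: sum_list_nonneg simp: less_imp_le)
  have s: "0 < s" using pos by (simp add: s_def)
  have f: "f = 2 * (a * b + s * (q + z) + cut_sum (s + (q + z)) (ys @ [l]) + z * (s + q + B + l))"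
    by (simp add: f_def kite_form_eq_cut_sum s_def B_def algebra_simps)
  show ?thesis
  proof (cases "z < B + l")
    case True
    have "kite_form (a # b # z # q # ys @ [l]) =
        2 * (a * b + s * z + (s + z) * (q + B + l) + cut_sum (s + (q + z)) (ys @ [l]))"
      by (simp add: kite_form_eq_cut_sum s_def B_def algebra_simps)
    moreover have "0 < s * (B + l - z)" using s True by simp
    ultimately show ?thesis by (simp add: f algebra_simps)
  next
    case False
    have "kite_form (a # b # l # rev ys @ [q, z]) =
        2 * (a * b + s * l + cut_sum (s + l) (rev ys @ [q + z]) + (s + l + B + q) * z)"
      by (simp add: kite_form_eq_cut_sum cut_sum_split_last sum_list_rev s_def B_def algebra_simps)
    moreover have "cut_sum s (l # rev ys @ [q + z]) =
        s * (l + B + q + z) + cut_sum (s + l) (rev ys @ [q + z])"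
      by (simp add: B_def sum_list_rev)
    moreover have "cut_sum (s + (q + z)) (ys @ [l]) + s * (3 * (q + z) + B - l)
        \<le> cut_sum s (l # rev ys @ [q + z])"
      unfolding B_def using False pos s \<open>ys \<noteq> []\<close>
      by (intro cut_sum_rev_ge_last) (auto simp: B_def less_imp_le)
    moreover have "0 < s * (q + z - l)" using s False B pos by simp
    ultimately have "f < kite_form (a # b # l # rev ys @ [q, z])"
      unfolding f by (simp add: B_def[symmetric] algebra_simps)
    then show ?thesis ..
  qed
qed

lemma kite_form_swap1: "kite_form (a # b # c # ys) = kite_form (b # a # c # ys)"
  by (simp add: kite_form_eq_cut_sum algebra_simps)

lemma kite_form_swap2: "kite_form (a # b # c # ys) = kite_form (a # c # b # ys)"
  by (simp add: kite_form_eq_cut_sum algebra_simps)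

section \<open>Attaching a vertex\<close>

lemma kite_form_add_pendant_path:
  fixes x :: "'a \<Rightarrow> real"
  assumes "distinct (a # b # c # ys)" "u \<in> set ys" "v \<notin> set (a # b # c # ys)"
    and pos: "\<forall>w\<in>insert v (set (a # b # c # ys)). 0 < x w"
  defines "f \<equiv> kite_form (map (x(u := x u + x v)) (a # b # c # ys)) +
    2 * x v * sum_list (map x (a # b # c # ys))"
  shows "\<exists>vs'. distinct vs' \<and> set vs' = insert v (set (a # b # c # ys)) \<and>
    (f < kite_form (map x vs') \<or>
     f = kite_form (map x vs') \<and> vs' = (a # b # c # ys) @ [v] \<and> last ys = u)"
proof -
  obtain us ws where ys: "ys = us @ u # ws"
    using assms(2) by (meson split_list)
  have upd: "map (x(u := x u + x v)) us = map x us" "map (x(u := x u + x v)) ws = map x ws"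
    "a \<noteq> u" "b \<noteq> u" "c \<noteq> u"
    using assms(1) by (auto simp: ys)
  have f: "f = kite_form (x a # x b # x c # map x us @ (x u + x v) # map x ws) +
      2 * x v * (x a + x b + x c + sum_list (map x us) + x u + sum_list (map x ws))"
    by (simp add: f_def ys upd add_ac)
  show ?thesis
  proof (cases "ws = []")
    case True
    then have "f = kite_form (map x ((a # b # c # ys) @ [v]))"
      by (simp add: f kite_form_pendant_last ys)
    then show ?thesis
      using assms(1,3) True by (intro exI[of _ "(a # b # c # ys) @ [v]"]) (auto simp: ys)
  next
    case False
    then have "f < kite_form (x a # x b # x c # map x us @ x v # x u # map x ws) \<or>
        f < kite_form (x a # x b # x c # map x us @ rev (map x ws) @ [x u, x v])"
      unfolding f using pos by (intro kite_form_pendant_path) (auto simp: ys)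
    then have "f < kite_form (map x (a # b # c # us @ v # u # ws)) \<or>
        f < kite_form (map x (a # b # c # us @ rev ws @ [u, v]))"
      by (simp add: rev_map)
    moreover have "distinct (a # b # c # us @ v # u # ws)" "distinct (a # b # c # us @ rev ws @ [u, v])"
      using assms(1,3) by (auto simp: ys)
    moreover have "set (a # b # c # us @ v # u # ws) = insert v (set (a # b # c # ys))"
      "set (a # b # c # us @ rev ws @ [u, v]) = insert v (set (a # b # c # ys))"
      by (auto simp: ys)
    ultimately show ?thesis by metis
  qed
qed

lemma kite_form_add_pendant_triangle:
  fixes x :: "'a \<Rightarrow> real"
  assumes "distinct (a # b # u # ys)" "ys \<noteq> []" "v \<notin> set (a # b # u # ys)"
    and pos: "\<forall>w\<in>insert v (set (a # b # u # ys)). 0 < x w"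
  defines "f \<equiv> kite_form (map (x(u := x u + x v)) (a # b # u # ys)) +
    2 * x v * sum_list (map x (a # b # u # ys))"
  shows "\<exists>vs'. distinct vs' \<and> set vs' = insert v (set (a # b # u # ys)) \<and>
    (f < kite_form (map x vs') \<or>
     f = kite_form (map x vs') \<and> length ys = 1 \<and> vs' = [a, b, last ys, u, v])"
proof -
  obtain ys' l where ys: "ys = ys' @ [l]"
    using assms(2) by (metis rev_exhaust)
  have upd: "map (x(u := x u + x v)) ys' = map x ys'"
    "a \<noteq> u" "b \<noteq> u" "l \<noteq> u"
    using assms(1) by (auto simp: ys)
  have f: "f = kite_form (x a # x b # (x u + x v) # map x ys' @ [x l]) +
      2 * x v * (x a + x b + x u + sum_list (map x ys') + x l)"
    by (simp add: f_def ys upd add_ac)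
  show ?thesis
  proof (cases "ys' = []")
    case True
    \<comment> \<open>The old kite is a complete graph on four vertices, where exchanging
      \<open>u\<close> and \<open>l\<close> costs nothing and makes \<open>u\<close> the attachment
      vertex.\<close>
    have "f = kite_form (map x [a, b, l, u, v])"
      by (simp add: f True kite_form_eq_cut_sum algebra_simps)
    then show ?thesis
      using assms(1,3) True by (intro exI[of _ "[a, b, l, u, v]"]) (auto simp: ys)
  next
    case False
    then have "f < kite_form (x a # x b # x v # x u # map x ys' @ [x l]) \<or>
        f < kite_form (x a # x b # x l # rev (map x ys') @ [x u, x v])"
      unfolding f using pos by (intro kite_form_pendant_triangle) (auto simp: ys)
    then have "f < kite_form (map x (a # b # v # u # ys' @ [l])) \<or>
        f < kite_form (map x (a # b # l # rev ys' @ [u, v]))"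
      by (simp add: rev_map)
    moreover have "distinct (a # b # v # u # ys' @ [l])" "distinct (a # b # l # rev ys' @ [u, v])"
      using assms(1,3) by (auto simp: ys)
    moreover have "set (a # b # v # u # ys' @ [l]) = insert v (set (a # b # u # ys))"
      "set (a # b # l # rev ys' @ [u, v]) = insert v (set (a # b # u # ys))"
      by (auto simp: ys)
    ultimately show ?thesis by metis
  qed
qed

text \<open>The three triangle positions are interchangeable, so a triangle vertex \<open>u\<close>
  may be taken in third place. The case \<open>last\<close> keeps what the discussion of equality
  needs: an order \<open>ws\<close> of the old vertices that ends in \<open>u\<close> and differs
  from \<open>vs\<close> only for a kite of order four.\<close>

lemma kite_form_add_pendant:
  fixes x :: "'a \<Rightarrow> real"
  assumes "distinct vs" "4 \<le> length vs" "u \<in> set vs" "v \<notin> set vs"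
    and pos: "\<forall>w\<in>insert v (set vs). 0 < x w"
  defines "f \<equiv> kite_form (map (x(u := x u + x v)) vs) + 2 * x v * sum_list (map x vs)"
  obtains (strict) vs' where "distinct vs'" "set vs' = insert v (set vs)" "f < kite_form (map x vs')"
  | (last) ws where "f = kite_form (map x (ws @ [v]))" "distinct ws" "set ws = set vs" "last ws = u"
      "ws = vs \<or> length vs = 4"
proof -
  obtain a b c ys where vs: "vs = a # b # c # ys" and ys: "ys \<noteq> []"
  proof -
    obtain a b c e ys where "vs = a # b # c # e # ys"
      using assms(2) by (auto simp: numeral_eq_Suc Suc_le_length_iff)
    then show thesis using that by blast
  qed
  have triangle: thesis
    if f: "f = kite_form (map (x(u := x u + x v)) (p # q # u # ys)) +
        2 * x v * sum_list (map x (p # q # u # ys))"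
      and dist: "distinct (p # q # u # ys)" and set: "set (p # q # u # ys) = set vs" for p q
  proof -
    have "v \<notin> set (p # q # u # ys)" "\<forall>w\<in>insert v (set (p # q # u # ys)). 0 < x w"
      using assms(4) pos unfolding set by auto
    then obtain vs' where "distinct vs'" "set vs' = insert v (set vs)" and
      *: "f < kite_form (map x vs') \<or>
        f = kite_form (map x vs') \<and> length ys = 1 \<and> vs' = [p, q, last ys, u, v]"
      using kite_form_add_pendant_triangle[OF dist ys, of v x] unfolding f set by metis
    from * show thesis
    proof
      assume "f < kite_form (map x vs')"
      then show thesis by (rule strict[OF \<open>distinct vs'\<close> \<open>set vs' = _\<close>])
    next
      assume l: "f = kite_form (map x vs') \<and> length ys = 1 \<and> vs' = [p, q, last ys, u, v]"
      then obtain l where "ys = [l]" by (auto simp: length_Suc_conv)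
      with l dist set show thesis
        by (intro last[of "[p, q, l, u]"]) (auto simp: vs)
    qed
  qed
  consider "u \<in> set ys" | "u = a" | "u = b" | "u = c"
    using assms(3) vs by auto
  then show thesis
  proof cases
    case 1
    obtain vs' where "distinct vs'" "set vs' = insert v (set vs)" and
      *: "f < kite_form (map x vs') \<or> f = kite_form (map x vs') \<and> vs' = vs @ [v] \<and> last ys = u"
      using kite_form_add_pendant_path[of a b c ys u v x] assms(1,4) pos 1 unfolding f_def vs by metis
    from * show thesis
    proof
      assume "f < kite_form (map x vs')"
      then show thesis by (rule strict[OF \<open>distinct vs'\<close> \<open>set vs' = _\<close>])
    next
      assume "f = kite_form (map x vs') \<and> vs' = vs @ [v] \<and> last ys = u"
      then show thesis
        using assms(1) ys by (intro last[of vs]) (auto simp: vs)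
    qed
  next
    case 2
    have "a \<noteq> b" "a \<noteq> c" using assms(1) by (auto simp: vs)
    then show thesis
      using assms(1) 2 by (intro triangle[of b c])
        (auto simp: f_def vs kite_form_swap1[of "x a + x v"] kite_form_swap2[of _ "x a + x v"])
  next
    case 3
    have "b \<noteq> a" "b \<noteq> c" using assms(1) by (auto simp: vs)
    then show thesis
      using assms(1) 3 by (intro triangle[of a c])
        (auto simp: f_def vs kite_form_swap2[of _ "x b + x v"])
  next
    case 4
    then show thesis
      using assms(1) by (intro triangle[of a b]) (auto simp: f_def vs)
  qed
qed

section \<open>Domination by the kite form and its inheritance\<close>

definition dist_form :: "('a \<Rightarrow> 'a \<Rightarrow> nat) \<Rightarrow> 'a set \<Rightarrow> ('a \<Rightarrow> real) \<Rightarrow> real" where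
  "dist_form d U x = (\<Sum>u\<in>U. \<Sum>v\<in>U. real (d u v) * x u * x v)"

text \<open>The equality in the second alternative makes \<open>d\<close> the distance function of a kite on \<open>U\<close>.\<close>

definition kite_dominated :: "('a \<Rightarrow> 'a \<Rightarrow> nat) \<Rightarrow> 'a set \<Rightarrow> bool" where
  "kite_dominated d U \<longleftrightarrow>
     (\<forall>x. (\<forall>u\<in>U. 0 < x u) \<longrightarrow>
       (\<exists>vs. distinct vs \<and> set vs = U \<and>
         (dist_form d U x < kite_form (map x vs) \<or>
          dist_form d U x \<le> kite_form (map x vs) \<and>
          (\<forall>i<length vs. \<forall>j<length vs. d (vs ! i) (vs ! j) = kite_dist i j))))"

lemma dist_form_insert:
  assumes "finite U" "v \<notin> U" "d v v = 0" "\<And>w. w \<in> U \<Longrightarrow> d w v = d v w"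
  shows "dist_form d (insert v U) x =
    dist_form d U x + 2 * x v * (\<Sum>w\<in>U. real (d v w) * x w)"
proof -
  have "(\<Sum>w\<in>U. real (d w v) * x w * x v) = x v * (\<Sum>w\<in>U. real (d v w) * x w)"
    "(\<Sum>w\<in>U. real (d v w) * x v * x w) = x v * (\<Sum>w\<in>U. real (d v w) * x w)"
    by (auto simp: sum_distrib_left assms(4) intro!: sum.cong)
  then show ?thesis
    using assms(1-3) by (simp add: dist_form_def sum.distrib)
qed

lemma dist_form_fun_upd:
  assumes "finite U" "u \<in> U" "d u u = 0" "\<And>w. w \<in> U \<Longrightarrow> d w u = d u w"
  shows "dist_form d U (x(u := x u + t)) =
    dist_form d U x + 2 * t * (\<Sum>w\<in>U. real (d u w) * x w)"
proof -
  define V where "V = U - {u}"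
  have V: "U = insert u V" "u \<notin> V" "finite V" using assms(1,2) by (auto simp: V_def)
  have sym: "d w u = d u w" if "w \<in> V" for w using assms(4) that by (simp add: V_def)
  let ?y = "x(u := x u + t)"
  have 1: "dist_form d V ?y = dist_form d V x"
    unfolding dist_form_def using V(2) by (intro sum.cong) auto
  have 2: "(\<Sum>w\<in>V. real (d u w) * ?y w) = (\<Sum>w\<in>V. real (d u w) * x w)"
    using V(2) by (intro sum.cong) auto
  have 3: "dist_form d (insert u V) y =
      dist_form d V y + 2 * y u * (\<Sum>w\<in>V. real (d u w) * y w)" for y
    by (rule dist_form_insert[where d = d]) (simp_all add: V(2,3) assms(3) sym)
  have 4: "(\<Sum>w\<in>insert u V. real (d u w) * x w) = (\<Sum>w\<in>V. real (d u w) * x w)"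
    using V(2,3) by (simp add: assms(3))
  show ?thesis
    unfolding V(1) 3 4 1 2 by (simp add: algebra_simps)
qed

text \<open>
  Merging the weight of \<open>v\<close> into \<open>u\<close> loses at most the length of the edge between them for each of
  the other vertices, which is the term gained when \<open>v\<close> is hung at \<open>u\<close>.
\<close>

lemma kite_dominated_insert:
  assumes "finite U" "4 \<le> card U" "u \<in> U" "v \<notin> U"
    and self: "\<And>w. w \<in> insert v U \<Longrightarrow> d w w = 0"
    and sym: "\<And>w z. w \<in> insert v U \<Longrightarrow> z \<in> insert v U \<Longrightarrow> d w z = d z w"
    and adj: "\<And>w. w \<in> U \<Longrightarrow> d v w \<le> Suc (d u w)"
    and dom: "kite_dominated d U"
  shows "kite_dominated d (insert v U)"
  unfolding kite_dominated_def
proof (intro allI impI)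
  fix x :: "'a \<Rightarrow> real" assume pos: "\<forall>u\<in>insert v U. 0 < x u"
  let ?x = "x(u := x u + x v)"
  have "\<forall>u\<in>U. 0 < ?x u" using pos assms(3) by (simp add: add_pos_pos)
  then have "\<exists>vs. distinct vs \<and> set vs = U \<and> (dist_form d U ?x < kite_form (map ?x vs) \<or>
      dist_form d U ?x \<le> kite_form (map ?x vs) \<and>
      (\<forall>i<length vs. \<forall>j<length vs. d (vs ! i) (vs ! j) = kite_dist i j))"
    by (rule dom[unfolded kite_dominated_def, THEN spec[of _ ?x], THEN mp])
  then obtain vs where vs: "distinct vs" "set vs = U" and
    le: "dist_form d U ?x < kite_form (map ?x vs) \<or>
      dist_form d U ?x \<le> kite_form (map ?x vs) \<and>
      (\<forall>i<length vs. \<forall>j<length vs. d (vs ! i) (vs ! j) = kite_dist i j)"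
    by blast
  have sum: "sum_list (map x vs) = (\<Sum>w\<in>U. x w)"
    using vs by (simp add: sum_list_distinct_conv_sum_set)
  have len: "length vs = card U" using distinct_card[OF vs(1)] vs(2) by simp
  have self_v: "d v v = 0" and self_u: "d u u = 0"
    using assms(3) by (simp_all add: self)
  have sym_v: "d w v = d v w" if "w \<in> U" for w
    by (rule sym) (simp_all add: that)
  have sym_u: "d w u = d u w" if "w \<in> U" for w
    by (rule sym) (simp_all add: that assms(3))
  have ins: "dist_form d (insert v U) x = dist_form d U x + 2 * x v * (\<Sum>w\<in>U. real (d v w) * x w)"
    by (rule dist_form_insert[where d = d, OF assms(1,4) self_v sym_v])
  have upd: "dist_form d U ?x = dist_form d U x + 2 * x v * (\<Sum>w\<in>U. real (d u w) * x w)"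
    by (rule dist_form_fun_upd[where d = d, OF assms(1,3) self_u sym_u])
  \<comment> \<open>The slack in \<open>d v w <= d u w + 1\<close>, weighted by \<open>x\<close>. As
    the weights are positive, it vanishes exactly when \<open>v\<close> is pendant at
    \<open>u\<close> with respect to \<open>d\<close>.\<close>
  let ?D = "\<Sum>w\<in>U. real (Suc (d u w) - d v w) * x w"
  have "(\<Sum>w\<in>U. real (d v w) * x w) = (\<Sum>w\<in>U. real (d u w) * x w) + (\<Sum>w\<in>U. x w) - ?D"
    using adj by (subst sum.distrib[symmetric], subst sum_subtractf[symmetric], intro sum.cong)
      (auto simp: of_nat_diff algebra_simps)
  then have eq: "dist_form d (insert v U) x = dist_form d U ?x + 2 * x v * sum_list (map x vs) - 2 * x v * ?D"
    by (simp add: ins upd sum distrib_left right_diff_distrib del: of_nat_Suc)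
  have nonneg: "0 \<le> real (Suc (d u w) - d v w) * x w" if "w \<in> U" for w
    using pos that by (simp add: less_imp_le)
  have D0: "0 \<le> ?D" using nonneg by (intro sum_nonneg)
  have xv: "0 < x v" using pos by simp
  have xD0: "0 \<le> 2 * x v * ?D" using D0 xv by simp
  have le': "dist_form d (insert v U) x \<le> kite_form (map ?x vs) + 2 * x v * sum_list (map x vs)"
    using eq le xD0 by linarith
  have pre: "distinct vs" "4 \<le> length vs" "u \<in> set vs" "v \<notin> set vs"
    "\<forall>w\<in>insert v (set vs). 0 < x w" using vs assms(2-4) len pos by auto
  from pre show "\<exists>vs. distinct vs \<and> set vs = insert v U \<and>
      (dist_form d (insert v U) x < kite_form (map x vs) \<or>
       dist_form d (insert v U) x \<le> kite_form (map x vs) \<and>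
       (\<forall>i<length vs. \<forall>j<length vs. d (vs ! i) (vs ! j) = kite_dist i j))"
  proof (cases rule: kite_form_add_pendant)
    case (strict vs')
    then have "dist_form d (insert v U) x < kite_form (map x vs')" using le' by linarith
    then show ?thesis using strict(1,2) vs(2) by blast
  next
    case (last ws)
    show ?thesis
    proof (cases "dist_form d U ?x < kite_form (map ?x vs) \<or> 0 < ?D")
      case True
      then have "dist_form d (insert v U) x < kite_form (map ?x vs) + 2 * x v * sum_list (map x vs)"
      proof
        assume "0 < ?D"
        then have "0 < 2 * x v * ?D" using xv by simp
        then show ?thesis using eq le by linarith
      qed (use eq le xD0 in linarith)
      then show ?thesis
        using last vs assms(4) by (intro exI[of _ "ws @ [v]"]) auto
    next
      case False
      then have kd: "\<forall>i<length vs. \<forall>j<length vs. d (vs ! i) (vs ! j) = kite_dist i j"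
        using le by auto
      have "?D = 0" using False D0 by simp
      then have dv: "d v w = Suc (d u w)" if "w \<in> U" for w
      proof -
        have "real (Suc (d u w) - d v w) * x w = 0"
          by (rule sum_nonneg_0[OF assms(1) nonneg \<open>?D = 0\<close> that])
        moreover have "x w \<noteq> 0" using pos that by force
        ultimately show ?thesis using adj[OF that] by simp
      qed
      have lw: "length ws = length vs"
        using distinct_card[OF last(2)] distinct_card[OF vs(1)] last(3) by simp
      have kdw: "d (ws ! i) (ws ! j) = kite_dist i j" if ij: "i < length ws" "j < length ws" for i j
        using last(5)
      proof
        assume "ws = vs"
        then show ?thesis using ij kd by blast
      next
        \<comment> \<open>The four vertices are mutually at distance 1, so reordering them leaves
          the table of distances unchanged.\<close>
        assume "length vs = 4"
        then have le1: "kite_dist i j = (if i = j then 0 else 1)" if "i < 4" "j < 4" for i j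
          using that by (auto simp: kite_dist_def)
        have "ws ! i \<in> set vs" "ws ! j \<in> set vs"
          unfolding last(3)[symmetric] using ij by (auto intro: nth_mem)
        then obtain i' j' where *: "i' < length vs" "vs ! i' = ws ! i" "j' < length vs" "vs ! j' = ws ! j"
          unfolding in_set_conv_nth by blast
        have "i = j \<longleftrightarrow> i' = j'"
          using nth_eq_iff_index_eq[OF last(2) ij] nth_eq_iff_index_eq[OF vs(1) *(1,3)]
          by (simp only: *(2,4))
        moreover have "d (ws ! i) (ws ! j) = kite_dist i' j'"
          using kd *(1,3) by (simp only: *(2,4)[symmetric])
        ultimately show ?thesis
          using ij *(1,3) lw by (simp only: le1 \<open>length vs = 4\<close>)
      qed
      have u: "u = ws ! (length ws - 1)"
        using last(4) lw pre(2) last_conv_nth[of ws] by force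
      have kv: "d (ws ! i) v = kite_dist i (length ws)" if "i < length ws" for i
      proof -
        have iU: "ws ! i \<in> U" using that last(3) vs(2) nth_mem by blast
        have "d (ws ! i) v = d v (ws ! i)" "d u (ws ! i) = d (ws ! i) u"
          using iU assms(3) by (auto intro: sym)
        then have 1: "d (ws ! i) v = Suc (d (ws ! i) u)"
          using dv[OF iU] by simp
        have "length ws - 1 < length ws" using that by linarith
        then have "d (ws ! i) (ws ! (length ws - 1)) = kite_dist i (length ws - 1)"
          by (rule kdw[OF that])
        then have 2: "d (ws ! i) u = kite_dist i (length ws - 1)" by (simp only: u[symmetric])
        have "kite_dist i (Suc (length ws - 1)) = Suc (kite_dist i (length ws - 1))"
          by (rule kite_dist_Suc_right) (use that lw pre(2) in linarith)+
        moreover have "Suc (length ws - 1) = length ws" using that by linarith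
        ultimately show ?thesis by (simp only: 1 2)
      qed
      have kv': "d v (ws ! i) = kite_dist (length ws) i" if "i < length ws" for i
      proof -
        have "ws ! i \<in> U" using that last(3) vs(2) nth_mem by blast
        then have "d v (ws ! i) = d (ws ! i) v" by (intro sym) auto
        then show ?thesis using kv[OF that] by (simp add: kite_dist_commute)
      qed
      have "\<forall>i<length (ws @ [v]). \<forall>j<length (ws @ [v]). d ((ws @ [v]) ! i) ((ws @ [v]) ! j) = kite_dist i j"
        using kdw kv kv' self[of v] by (auto simp: nth_append less_Suc_eq)
      moreover have "distinct (ws @ [v])" "set (ws @ [v]) = insert v U"
        using last vs assms(4) by auto
      moreover have "dist_form d (insert v U) x \<le> kite_form (map x (ws @ [v]))"
        using le' last(1) by simp
      ultimately show ?thesis by blast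
    qed
  qed
qed

section \<open>Sorted weights on the kite\<close>

text \<open>
  The weights in decreasing order occupy alternately the first and the last free position of the
  kite of order \<open>m\<close>.
\<close>

definition rank_pos :: "nat \<Rightarrow> nat \<Rightarrow> nat" where
  "rank_pos m u = (if even u then u div 2 else m - 1 - u div 2)"

definition rank_dist :: "nat \<Rightarrow> nat \<Rightarrow> nat \<Rightarrow> nat" where
  "rank_dist m u v = kite_dist (rank_pos m u) (rank_pos m v)"

text \<open>The coefficient that summation by parts attaches to a pair of weight decrements.\<close>

definition rank_sum :: "nat \<Rightarrow> nat \<Rightarrow> nat \<Rightarrow> nat" where
  "rank_sum m i j = (\<Sum>u<i. \<Sum>v<j. rank_dist m u v)"

text \<open>
  Bounds the sum of the distances from one of \<open>j\<close> vertices to the others: the summand \<open>k\<close> counts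
  those at distance at least \<open>k + 2\<close>.
\<close>

definition layer_bound :: "nat \<Rightarrow> nat \<Rightarrow> nat" where
  "layer_bound m j = (j - 1) + (\<Sum>k<m. min (j - 1) (m - 4 - 2 * k))"

lemma rank_pos_less: "u < m \<Longrightarrow> rank_pos m u < m"
  by (auto simp: rank_pos_def)

lemma rank_pos_inj: "inj_on (rank_pos m) {..<m}"
proof (rule inj_onI)
  fix u v assume uv: "u \<in> {..<m}" "v \<in> {..<m}" "rank_pos m u = rank_pos m v"
  obtain a b where "u = 2 * a \<or> u = 2 * a + 1" "v = 2 * b \<or> v = 2 * b + 1"
    by (metis evenE oddE)
  then show "u = v" using uv by (elim disjE) (auto simp: rank_pos_def)
qed

lemma rank_pos_bij: "bij_betw (rank_pos m) {..<m} {..<m}"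
  unfolding bij_betw_def using rank_pos_inj[of m]
  by (intro conjI endo_inj_surj) (auto simp: rank_pos_less)

lemma rank_dist_commute: "rank_dist m u v = rank_dist m v u"
  by (simp add: rank_dist_def kite_dist_commute)

lemma rank_dist_self [simp]: "rank_dist m u u = 0"
  by (simp add: rank_dist_def)

lemma rank_dist_ge_one: "u < m \<Longrightarrow> v < m \<Longrightarrow> u \<noteq> v \<Longrightarrow> 1 \<le> rank_dist m u v"
  unfolding rank_dist_def using rank_pos_inj[of m]
  by (intro kite_dist_ge_one) (auto simp: inj_on_def)

lemma rank_sum_commute: "rank_sum m i j = rank_sum m j i"
  unfolding rank_sum_def by (subst sum.swap) (simp add: rank_dist_commute)

lemma rank_sum_Suc_right: "rank_sum m i (Suc j) = rank_sum m i j + (\<Sum>u<i. rank_dist m u j)"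
  by (simp add: rank_sum_def sum.distrib)

section \<open>Lengthening the kite by two\<close>

lemma kite_dist_add_two:
  "2 \<le> p \<Longrightarrow> 2 \<le> q \<Longrightarrow> kite_dist (p + 2) (q + 2) = kite_dist p q"
  "p < q \<Longrightarrow> 3 \<le> q \<Longrightarrow> kite_dist p (q + 2) = kite_dist p q + 2"
proof -
  assume "2 \<le> p" "2 \<le> q"
  then obtain p' q' where "p = p' + 2" "q = q' + 2" by (metis le_add_diff_inverse2)
  then show "kite_dist (p + 2) (q + 2) = kite_dist p q" by (simp add: kite_dist_def)
next
  assume pq: "p < q" "3 \<le> q"
  then have "p - 2 - (q - 2) = 0" "p - 2 - (q + 2 - 2) = 0" "q + 2 - 2 - (p - 2) = q - 2 - (p - 2) + 2"
    "1 \<le> q - 2 - (p - 2)" "p \<noteq> q" "p \<noteq> q + 2"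
    by linarith+
  then show "kite_dist p (q + 2) = kite_dist p q + 2"
    by (simp only: kite_dist_def if_False) simp
qed

lemma rank_pos_odd:
  assumes "5 \<le> m" "v < m" "odd v"
  shows "rank_pos (m + 2) v = rank_pos m v + 2" "3 \<le> rank_pos m v"
    "u < m \<Longrightarrow> even u \<Longrightarrow> rank_pos m u < rank_pos m v"
proof -
  obtain b where b: "v = 2 * b + 1" using assms(3) by (elim oddE)
  show "rank_pos (m + 2) v = rank_pos m v + 2" "3 \<le> rank_pos m v"
    using assms by (auto simp: rank_pos_def b)
  assume "u < m" "even u"
  then obtain a where "u = 2 * a" by (elim evenE)
  with \<open>u < m\<close> assms(2) show "rank_pos m u < rank_pos m v"
    by (simp add: rank_pos_def b)
qed

lemma rank_pos_even: "even u \<Longrightarrow> rank_pos (m + 2) u = rank_pos m u"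
  by (simp add: rank_pos_def)

text \<open>The two new positions lie between the two ends: even ranks stay, odd ranks move outwards
  by two. For \<open>m = 4\<close> this fails: rank 3 sits at position 2, inside the triangle, and
  on moving to position 4 its distance from position 0 grows by 1 only.\<close>

lemma rank_dist_add_two:
  assumes m: "5 \<le> m" and u: "u < m" and v: "v < m"
  shows "rank_dist (m + 2) u v = rank_dist m u v + (if even u = even v then 0 else 2)"
proof -
  have mixed: "rank_dist (m + 2) p q = rank_dist m p q + 2"
    if "even p" "odd q" "p < m" "q < m" for p q
    unfolding rank_dist_def rank_pos_even[OF that(1)] rank_pos_odd(1)[OF m that(4,2)]
    using rank_pos_odd(2,3)[OF m that(4,2)] that by (intro kite_dist_add_two)
  consider "even u" "even v" | "odd u" "odd v" | "even u" "odd v" | "odd u" "even v" by blast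
  then show ?thesis
  proof cases
    case 1
    then show ?thesis by (simp add: rank_dist_def rank_pos_even del: add_2_eq_Suc add_2_eq_Suc')
  next
    case 2
    have "2 \<le> rank_pos m u" "2 \<le> rank_pos m v"
      using rank_pos_odd(2)[OF m u 2(1)] rank_pos_odd(2)[OF m v 2(2)] by linarith+
    then show ?thesis
      using 2 unfolding rank_dist_def rank_pos_odd(1)[OF m u 2(1)] rank_pos_odd(1)[OF m v 2(2)]
      by (simp only: kite_dist_add_two) simp
  next
    case 3
    then show ?thesis using mixed[OF 3 u v] by (simp only:) simp
  next
    case 4
    then show ?thesis using mixed[OF 4(2,1) v u] rank_dist_commute by metis
  qed
qed

lemma sum_alternating: "(\<Sum>u<i. (- 1) ^ u :: int) = (if odd i then 1 else 0)"
  by (induction i) auto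

text \<open>Twice the indicator of different parity is \<open>1 - (-1)^u * (-1)^v\<close>, so the
  double sum is \<open>i * j\<close> minus a product of two alternating sums, each 0 or 1.\<close>

lemma parity_sum:
  "(\<Sum>u<i. \<Sum>v<j. if even u = even v then 0 else 2 :: nat) + (if odd i \<and> odd j then 1 else 0) = i * j"
  (is "?N + _ = _")
proof -
  have "int ?N =
      (\<Sum>u<i. \<Sum>v<j. 1 - (- 1) ^ u * (- 1) ^ v)"
    by (simp add: of_nat_sum) (intro sum.cong; auto)
  also have "\<dots> = int (i * j) - (\<Sum>u<i. (- 1) ^ u) * (\<Sum>v<j. (- 1) ^ v)"
    by (simp add: sum_subtractf sum_product)
  also have "\<dots> = int (i * j) - (if odd i \<and> odd j then 1 else 0)"
    unfolding sum_alternating by simp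
  finally have eq: "int ?N = int (i * j) - (if odd i \<and> odd j then 1 else 0)" .
  have "N + (if c then 1 else 0) = p" if "int N = int p - (if c then 1 else 0)" for N p c
    using that by (cases c) auto
  from this[OF eq] show ?thesis .
qed

lemma rank_sum_add_two:
  assumes "5 \<le> m" "i \<le> m" "j \<le> m"
  shows "rank_sum m i j + i * j \<le> rank_sum (m + 2) i j + 1"
proof -
  have "rank_sum (m + 2) i j = rank_sum m i j + (\<Sum>u<i. \<Sum>v<j. if even u = even v then 0 else 2)"
    unfolding rank_sum_def sum.distrib[symmetric]
    using assms by (intro sum.cong refl rank_dist_add_two) auto
  then show ?thesis using parity_sum[of j i] by (auto split: if_splits)
qed

text \<open>The layer index shifts by one and a single new layer appears. It adds at most
  \<open>j - 1\<close>, so \<open>i\<close> rows grow by at most \<open>i * j - i\<close>; for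
  \<open>i >= 1\<close> this stays within the growth of \<open>rank_sum\<close>, which is at least
  \<open>i * j - 1\<close>. The induction in steps of two rests on this comparison.\<close>

lemma layer_bound_add_two: "layer_bound (m + 2) j = layer_bound m j + min (j - 1) (m - 2)"
proof -
  have "(\<Sum>k<m + 2. min (j - 1) (m + 2 - 4 - 2 * k)) =
      min (j - 1) (m - 2) + (\<Sum>k<Suc m. min (j - 1) (m - 4 - 2 * k))"
    by (simp only: add_2_eq_Suc' sum.lessThan_Suc_shift) (simp add: numeral_eq_Suc)
  then show ?thesis by (simp add: layer_bound_def)
qed

text \<open>From \<open>j = m\<close> on, the caps \<open>m - 4 - 2 * k\<close> are the smaller
  arguments of \<open>min\<close>, and only the leading \<open>j - 1\<close> still grows.\<close>

lemma layer_bound_beyond: "m \<le> j \<Longrightarrow> 1 \<le> m \<Longrightarrow> layer_bound m j = layer_bound m m + (j - m)"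
proof -
  assume "m \<le> j" "1 \<le> m"
  then have "(\<Sum>k<m. min (j - 1) (m - 4 - 2 * k)) = (\<Sum>k<m. min (m - 1) (m - 4 - 2 * k))"
    by (intro sum.cong) auto
  then show ?thesis using \<open>m \<le> j\<close> \<open>1 \<le> m\<close> by (simp add: layer_bound_def)
qed

lemma kite_dist_triangle: "kite_dist i k \<le> kite_dist i j + kite_dist j k"
proof -
  have dist: "a - c + (c - a) \<le> (a - b + (b - a)) + (b - c + (c - b))" for a b c :: nat
    by linarith
  have max: "max 1 x \<le> max 1 y + max 1 z" if "x \<le> y + z" for x y z :: nat
    using that by linarith
  consider "i = k" | "i = j" | "j = k" | "i \<noteq> k" "i \<noteq> j" "j \<noteq> k" by blast
  then show ?thesis
  proof cases
    case 4
    show ?thesis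
      using max[OF dist[of "i - 2" "k - 2" "j - 2"]] 4 by (simp only: kite_dist_def if_False)
  qed auto
qed

lemma sum_pairs: "(\<Sum>v<2 * n. f v) = (\<Sum>t<n. f (2 * t) + f (2 * t + 1))" for f :: "nat \<Rightarrow> nat"
  by (induction n) (auto simp: add_ac)

text \<open>
  The ranks \<open>2t\<close> and \<open>2t + 1\<close> sit at opposite ends, so their distances to any third vertex
  add up to at least the distance between them.
\<close>

lemma layer_bound_le_transmission:
  assumes "4 \<le> m"
  shows "layer_bound m m \<le> (\<Sum>v<m. rank_dist (m + 2) p v)"
proof -
  have "(\<Sum>k<m. min (m - 1) (m - 4 - 2 * k)) \<le> (\<Sum>k<m. m - 4 - 2 * k)"
    by (intro sum_mono) auto
  also have "(\<Sum>k<m. m - 4 - 2 * k) = (\<Sum>k<m div 2 - 1. m - 4 - 2 * k)"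
  proof (rule sum.mono_neutral_right)
    show "\<forall>k\<in>{..<m} - {..<m div 2 - 1}. m - 4 - 2 * k = 0"
    proof
      fix k assume "k \<in> {..<m} - {..<m div 2 - 1}"
      then have "m div 2 \<le> k + 1" by auto
      then show "m - 4 - 2 * k = 0"
        using mult_div_mod_eq[of 2 m] mod_less_divisor[of 2 m] by linarith
    qed
  qed auto
  also have "\<dots> \<le> (\<Sum>k<m div 2 - 1. m - 1 - 2 * Suc k)"
    by (intro sum_mono) auto
  \<comment> \<open>The leading \<open>m - 1\<close> becomes the summand \<open>t = 0\<close>, and
    layer \<open>k\<close> is absorbed by the summand \<open>t = k + 1\<close>.\<close>
  finally have "layer_bound m m \<le> (\<Sum>t<Suc (m div 2 - 1). m - 1 - 2 * t)"
    unfolding layer_bound_def sum.lessThan_Suc_shift by simp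
  also have "Suc (m div 2 - 1) = m div 2" using assms by auto
  also have "(\<Sum>t<m div 2. m - 1 - 2 * t) \<le>
      (\<Sum>t<m div 2. rank_dist (m + 2) p (2 * t) + rank_dist (m + 2) p (2 * t + 1))"
  proof (rule sum_mono)
    fix t assume "t \<in> {..<m div 2}"
    then have "2 * t + 1 < m" by auto
    then have "m - 1 - 2 * t \<le> kite_dist t (m + 1 - t)"
      by (auto simp: kite_dist_def)
    also have "\<dots> = kite_dist (rank_pos (m + 2) (2 * t)) (rank_pos (m + 2) (2 * t + 1))"
      by (simp add: rank_pos_def)
    also have "\<dots> \<le> rank_dist (m + 2) p (2 * t) + rank_dist (m + 2) p (2 * t + 1)"
      unfolding rank_dist_def
      using kite_dist_triangle[of "rank_pos (m + 2) (2 * t)" "rank_pos (m + 2) (2 * t + 1)" "rank_pos (m + 2) p"]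
      by (simp add: kite_dist_commute)
    finally show "m - 1 - 2 * t \<le> rank_dist (m + 2) p (2 * t) + rank_dist (m + 2) p (2 * t + 1)" .
  qed
  also have "\<dots> = (\<Sum>v<2 * (m div 2). rank_dist (m + 2) p v)"
    by (simp add: sum_pairs)
  also have "\<dots> \<le> (\<Sum>v<m. rank_dist (m + 2) p v)"
    by (intro sum_mono2) auto
  finally show ?thesis .
qed

text \<open>For a function with zero diagonal and the layer caps, \<open>i * layer_bound m j\<close>
  bounds the sum over the leading \<open>i\<close> by \<open>j\<close> block. The restriction to
  \<open>i <= j\<close> ensures that each of the \<open>i\<close> rows contains its diagonal zero.
  The strict clause for the full block is the source of strictness for sets of at least five
  vertices.\<close>

definition rank_sums_dominate :: "nat \<Rightarrow> bool" where
  "rank_sums_dominate m \<longleftrightarrow>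
     (\<forall>i j. i \<le> j \<longrightarrow> j \<le> m \<longrightarrow> i * layer_bound m j \<le> rank_sum m i j) \<and>
     (5 \<le> m \<longrightarrow> m * layer_bound m m < rank_sum m m m)"

text \<open>Only list sums and bounded quantifiers remain, so concrete values of \<open>m\<close>
  can be evaluated.\<close>

lemma rank_sums_dominate_list:
  "rank_sums_dominate m \<longleftrightarrow>
     (\<forall>j\<in>set [0..<Suc m]. \<forall>i\<in>set [0..<Suc j].
       i * ((j - 1) + sum_list (map (\<lambda>k. min (j - 1) (m - 4 - 2 * k)) [0..<m])) \<le>
         sum_list (map (\<lambda>u. sum_list (map (rank_dist m u) [0..<j])) [0..<i])) \<and>
     (5 \<le> m \<longrightarrow>
       m * ((m - 1) + sum_list (map (\<lambda>k. min (m - 1) (m - 4 - 2 * k)) [0..<m])) <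
         sum_list (map (\<lambda>u. sum_list (map (rank_dist m u) [0..<m])) [0..<m]))"
  unfolding rank_sums_dominate_def layer_bound_def rank_sum_def
  by (auto simp: interv_sum_list_conv_sum_set_nat atLeast0LessThan simp del: upt_Suc)

lemma rank_sums_dominate_4: "rank_sums_dominate 4"
  unfolding rank_sums_dominate_list by code_simp

lemma rank_sums_dominate_5: "rank_sums_dominate 5"
  unfolding rank_sums_dominate_list by code_simp

lemma rank_sums_dominate_6: "rank_sums_dominate 6"
  unfolding rank_sums_dominate_list by code_simp

text \<open>Blocks of old ranks are settled by comparing growth. The ranks \<open>m\<close> and
  \<open>m + 1\<close>, which sit in the middle of the longer kite, are added separately: for blocks
  with at most \<open>m\<close> rows it is enough that the new distances are at least 1; the larger
  blocks use the sums \<open>T\<close> and \<open>T'\<close> of distances from the new ranks, both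
  at least \<open>g\<close>, which also absorb the 1 that parity may cost.\<close>

lemma rank_sums_dominate_add_two:
  assumes m: "5 \<le> m" and IH: "rank_sums_dominate m"
  shows "rank_sums_dominate (m + 2)"
proof -
  define g where "g = layer_bound m m"
  have g: "m \<le> g"
  proof -
    have "m - 4 \<le> (\<Sum>k<m. min (m - 1) (m - 4 - 2 * k))"
      using m by (intro order.trans[OF _ member_le_sum[of 0]]) auto
    then show ?thesis using m by (simp add: g_def layer_bound_def)
  qed
  have g1: "layer_bound (m + 2) (m + 1) = g + (m - 1)"
    and g2: "layer_bound (m + 2) (m + 2) = g + m"
    unfolding layer_bound_add_two g_def
    using m layer_bound_beyond[of m "m + 1"] layer_bound_beyond[of m "m + 2"] by auto
  let ?K = "rank_sum (m + 2)"
  have old: "i * layer_bound m j + i * j \<le> ?K i j + 1" if "i \<le> j" "j \<le> m" for i j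
  proof -
    have "i * layer_bound m j \<le> rank_sum m i j"
      using IH that unfolding rank_sums_dominate_def by blast
    then show ?thesis using rank_sum_add_two[OF m, of i j] that by linarith
  qed
  have strict: "m * g + m * m < ?K m m + 1"
  proof -
    have "m * g < rank_sum m m m"
      using IH m unfolding rank_sums_dominate_def g_def by blast
    then show ?thesis using rank_sum_add_two[OF m, of m m] by linarith
  qed
  have row: "i \<le> (\<Sum>u<i. rank_dist (m + 2) u p)" if "i \<le> p" "p < m + 2" for i p
  proof -
    have "(\<Sum>u<i. 1) \<le> (\<Sum>u<i. rank_dist (m + 2) u p)"
      by (intro sum_mono rank_dist_ge_one) (use that in auto)
    then show ?thesis by simp
  qed
  define T T' where "T = (\<Sum>v<m. rank_dist (m + 2) m v)" and "T' = (\<Sum>v<m. rank_dist (m + 2) (m + 1) v)"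
  have T: "g \<le> T" "g \<le> T'"
    unfolding g_def T_def T'_def using layer_bound_le_transmission[of m] m by auto
  have T_flip: "(\<Sum>u<m. rank_dist (m + 2) u m) = T" "(\<Sum>u<m. rank_dist (m + 2) u (m + 1)) = T'"
    by (simp_all add: T_def T'_def rank_dist_commute)
  have K1: "?K (m + 1) (m + 1) = ?K m m + 2 * T"
    using rank_sum_Suc_right[of "m + 2" "m + 1" m] rank_sum_Suc_right[of "m + 2" m m]
      rank_sum_commute[of "m + 2" "m + 1" m] T_flip by simp
  have K2: "?K (m + 1) (m + 2) = ?K (m + 1) (m + 1) + T' + rank_dist (m + 2) m (m + 1)"
    using rank_sum_Suc_right[of "m + 2" "m + 1" "m + 1"] T_flip by simp
  have K3: "?K (m + 2) (m + 2) = ?K (m + 1) (m + 2) + T' + rank_dist (m + 2) m (m + 1)"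
    using rank_sum_Suc_right[of "m + 2" "m + 2" "m + 1"]
      rank_sum_commute[of "m + 2" "m + 2" "m + 1"] T_flip by simp
  have d1: "1 \<le> rank_dist (m + 2) m (m + 1)" by (intro rank_dist_ge_one) auto
  have sq: "(m + 1) * (g + (m - 1)) + 1 = m * g + g + m * m"
    using m by (cases m) (auto simp: algebra_simps)
  have sq': "(m + 1) * (g + m) = m * g + g + m * m + m" "(m + 2) * (g + m) = m * g + 2 * g + m * m + 2 * m"
    by (auto simp: algebra_simps)
  show ?thesis
    unfolding rank_sums_dominate_def
  proof (intro conjI allI impI)
    fix i j assume ij: "i \<le> j" "j \<le> m + 2"
    show "i * layer_bound (m + 2) j \<le> ?K i j"
    proof (cases "i = 0")
      case True
      then show ?thesis by simp
    next
      case False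
      consider "j \<le> m" | "j = m + 1" "i \<le> m" | "j = m + 2" "i \<le> m" | "i = m + 1" "j = m + 1"
        | "i = m + 1" "j = m + 2" | "i = m + 2" "j = m + 2"
        using ij by linarith
      then show ?thesis
      proof cases
        case 1
        have "i * layer_bound (m + 2) j \<le> i * (layer_bound m j + (j - 1))"
          unfolding layer_bound_add_two by (intro mult_le_mono) auto
        moreover have "i * (j - 1) + i = i * j"
          using False ij by (cases j) auto
        ultimately show ?thesis
          using old[OF ij(1) 1] False by (simp add: distrib_left)
      next
        case 2
        have "i * (g + (m - 1)) + i = i * g + i * m" using m by (cases m) (auto simp: algebra_simps)
        then show ?thesis
          using old[of i m] rank_sum_Suc_right[of "m + 2" i m] row[of i m] 2 False g1 by (simp add: g_def)
      next
        case 3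
        have "i * (g + m) = i * g + i * m" by (simp add: algebra_simps)
        then show ?thesis
          using old[of i m] rank_sum_Suc_right[of "m + 2" i m] rank_sum_Suc_right[of "m + 2" i "m + 1"]
            row[of i m] row[of i "m + 1"] 3 False g2 by (simp add: g_def)
      next
        case 4
        show ?thesis
          unfolding 4 g1 using K1 T old[of m m, folded g_def] sq by linarith
      next
        case 5
        have "m + 1 \<le> T' + rank_dist (m + 2) m (m + 1)" using T g d1 by linarith
        then show ?thesis
          unfolding 5 g2 sq' using K1 K2 T old[of m m, folded g_def] by linarith
      next
        case 6
        show ?thesis
          unfolding 6 g2 sq' using K1 K2 K3 T old[of m m, folded g_def] d1 g by linarith
      qed
    qed
  next
    show "(m + 2) * layer_bound (m + 2) (m + 2) < ?K (m + 2) (m + 2)"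
      unfolding g2 sq' using K1 K2 K3 T strict d1 g by linarith
  qed
qed

lemma rank_sums_dominate: "4 \<le> m \<Longrightarrow> rank_sums_dominate m"
proof (induction m rule: less_induct)
  case (less m)
  \<comment> \<open>The inductive step starts from \<open>m - 2 >= 5\<close>, so 6 cannot be reached
    from 4 and is a third base case.\<close>
  consider "m = 4" | "m = 5" | "m = 6" | "7 \<le> m" using less.prems by linarith
  then show ?case
  proof cases
    case 4
    then have "rank_sums_dominate (m - 2)" by (intro less.IH) simp_all
    then have "rank_sums_dominate (m - 2 + 2)"
      using 4 by (intro rank_sums_dominate_add_two) simp_all
    moreover have "m - 2 + 2 = m" using 4 by simp
    ultimately show ?thesis by (simp only:)
  qed (simp_all add: rank_sums_dominate_4 rank_sums_dominate_5 rank_sums_dominate_6)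
qed

section \<open>Summation by parts\<close>

lemma summation_by_parts:
  fixes a X :: "nat \<Rightarrow> real"
  shows "(\<Sum>u<n. X u * a u) = (\<Sum>i<n. (X i - X (Suc i)) * (\<Sum>u<Suc i. a u)) + X n * (\<Sum>u<n. a u)"
  by (induction n) (auto simp: algebra_simps)

text \<open>One summation by parts in each index. The boundary terms vanish by
  \<open>X n = 0\<close>, which leaves products of decrements times sums over leading
  blocks.\<close>

lemma summation_by_parts_double:
  fixes c :: "nat \<Rightarrow> nat \<Rightarrow> real"
  assumes "X n = 0"
  shows "(\<Sum>u<n. \<Sum>v<n. c u v * X u * X v) =
    (\<Sum>i<n. \<Sum>j<n. (X i - X (Suc i)) * (X j - X (Suc j)) * (\<Sum>u<Suc i. \<Sum>v<Suc j. c u v))"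
proof -
  let ?Y = "\<lambda>i. X i - X (Suc i)"
  have 1: "(\<Sum>v<n. X v * f v) = (\<Sum>j<n. ?Y j * (\<Sum>v<Suc j. f v))" for f
    using summation_by_parts[of X f n] assms by simp
  have "(\<Sum>u<n. \<Sum>v<n. c u v * X u * X v) = (\<Sum>u<n. X u * (\<Sum>v<n. X v * c u v))"
    by (simp add: sum_distrib_left mult_ac)
  also have "\<dots> = (\<Sum>i<n. ?Y i * (\<Sum>u<Suc i. \<Sum>v<n. X v * c u v))"
    by (rule 1)
  also have "\<dots> = (\<Sum>i<n. ?Y i * (\<Sum>v<n. X v * (\<Sum>u<Suc i. c u v)))"
    by (subst sum.swap) (simp only: sum_distrib_left)
  also have "\<dots> = (\<Sum>i<n. ?Y i * (\<Sum>j<n. ?Y j * (\<Sum>v<Suc j. \<Sum>u<Suc i. c u v)))"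
    by (simp only: 1)
  also have "\<dots> = (\<Sum>i<n. \<Sum>j<n. ?Y i * ?Y j * (\<Sum>u<Suc i. \<Sum>v<Suc j. c u v))"
    by (subst sum.swap[of _ "{..<Suc _}"]) (simp only: sum_distrib_left mult.assoc)
  finally show ?thesis .
qed

section \<open>Counting vertices by distance layers\<close>

lemma sum_eq_sum_card_ge:
  fixes f :: "'b \<Rightarrow> nat"
  assumes "finite A" "\<And>v. v \<in> A \<Longrightarrow> f v \<le> n"
  shows "(\<Sum>v\<in>A. f v) = (\<Sum>k<n. card {v \<in> A. Suc k \<le> f v})"
proof -
  have "(\<Sum>v\<in>A. f v) = (\<Sum>v\<in>A. \<Sum>k<n. if Suc k \<le> f v then 1 else 0)"
  proof (rule sum.cong)
    fix v assume "v \<in> A"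
    then have "{..<n} \<inter> {k. Suc k \<le> f v} = {..<f v}"
      using assms(2)[of v] by auto
    then show "f v = (\<Sum>k<n. if Suc k \<le> f v then 1 else 0)"
      by (simp add: sum.If_cases)
  qed simp
  also have "\<dots> = (\<Sum>k<n. \<Sum>v\<in>A. if Suc k \<le> f v then 1 else 0)"
    by (rule sum.swap)
  also have "\<dots> = (\<Sum>k<n. card {v \<in> A. Suc k \<le> f v})"
    using assms(1) by (simp add: sum.If_cases Int_def)
  finally show ?thesis .
qed

text \<open>The sum is counted layer by layer. Every layer misses \<open>u\<close>, whence
  \<open>j - 1\<close>; from threshold 2 on the hypothesis gives a second cap, and no value reaches
  \<open>m\<close>, since the cap \<open>m - 2 * m\<close> is 0 in the natural numbers.\<close>

lemma sum_le_layer_bound: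
  fixes f :: "nat \<Rightarrow> nat"
  assumes "4 \<le> m" "u < j" "f u = 0" "j \<le> m"
    and layers: "\<And>k. 2 \<le> k \<Longrightarrow> card {v \<in> {..<m}. k \<le> f v} \<le> m - 2 * k"
  shows "(\<Sum>v<j. f v) \<le> layer_bound m j"
proof -
  have "card {v \<in> {..<m}. m \<le> f v} = 0"
    using layers[of m] assms(1) by auto
  then have fm: "f v < m" if "v < m" for v
    using that by (auto simp: not_le)
  have cj: "card {v \<in> {..<j}. Suc k \<le> f v} \<le> j - 1" for k
  proof -
    have "{v \<in> {..<j}. Suc k \<le> f v} \<subseteq> {..<j} - {u}" using assms(3) by auto
    then show ?thesis using card_mono[of "{..<j} - {u}"] assms(2) by simp
  qed
  have cm: "card {v \<in> {..<j}. Suc (Suc k) \<le> f v} \<le> m - 4 - 2 * k" for k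
  proof -
    have "card {v \<in> {..<j}. Suc (Suc k) \<le> f v} \<le> card {v \<in> {..<m}. Suc (Suc k) \<le> f v}"
      using assms(4) by (intro card_mono) auto
    also have "\<dots> \<le> m - 2 * Suc (Suc k)" by (rule layers) simp
    finally show ?thesis by simp
  qed
  have "(\<Sum>v<j. f v) = (\<Sum>k<Suc m. card {v \<in> {..<j}. Suc k \<le> f v})"
    using fm assms(4) by (intro sum_eq_sum_card_ge) (auto intro: less_imp_le le_SucI simp: less_imp_le)
  also have "\<dots> = card {v \<in> {..<j}. Suc 0 \<le> f v} + (\<Sum>k<m. card {v \<in> {..<j}. Suc (Suc k) \<le> f v})"
    by (rule sum.lessThan_Suc_shift)
  also have "\<dots> \<le> (j - 1) + (\<Sum>k<m. min (j - 1) (m - 4 - 2 * k))"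
    using cj cm by (intro add_mono sum_mono) auto
  finally show ?thesis by (simp add: layer_bound_def)
qed

text \<open>By summation by parts, \<open>F - f\<close> is a sum of products of two nonnegative
  decrements with a difference of leading block sums. These differences are nonnegative by
  \<open>rank_sums_dominate\<close> for \<open>i <= j\<close> and by symmetry otherwise. Strictness
  comes from the corner term, whose decrement is the smallest weight \<open>X (m - 1)\<close>
  itself.\<close>

lemma rank_form_ge:
  fixes e :: "nat \<Rightarrow> nat \<Rightarrow> nat" and X :: "nat \<Rightarrow> real"
  assumes m: "4 \<le> m"
    and self: "\<And>u. u < m \<Longrightarrow> e u u = 0"
    and sym: "\<And>u v. u < m \<Longrightarrow> v < m \<Longrightarrow> e u v = e v u"
    and layers: "\<And>u k. u < m \<Longrightarrow> 2 \<le> k \<Longrightarrow> card {v \<in> {..<m}. k \<le> e u v} \<le> m - 2 * k"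
    and dec: "\<And>u. u < m \<Longrightarrow> X (Suc u) \<le> X u" and X0: "X m = 0" and pos: "0 < X (m - 1)"
  defines "f \<equiv> (\<Sum>u<m. \<Sum>v<m. real (e u v) * X u * X v)"
    and "F \<equiv> (\<Sum>u<m. \<Sum>v<m. real (rank_dist m u v) * X u * X v)"
  shows "f \<le> F" "5 \<le> m \<Longrightarrow> f < F"
proof -
  define c where "c u v = real (rank_dist m u v) - real (e u v)" for u v
  define C where "C i j = (\<Sum>u<i. \<Sum>v<j. c u v)" for i j
  define E where "E i j = (\<Sum>u<i. \<Sum>v<j. e u v)" for i j
  have C: "C i j = real (rank_sum m i j) - real (E i j)" for i j
    by (simp add: C_def c_def E_def rank_sum_def sum_subtractf)
  have E: "E i j \<le> i * layer_bound m j" if "i \<le> j" "j \<le> m" for i j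
  proof -
    have "(\<Sum>v<j. e u v) \<le> layer_bound m j" if "u < i" for u
      using that \<open>i \<le> j\<close> \<open>j \<le> m\<close> m self layers by (intro sum_le_layer_bound[of m u]) auto
    then have "E i j \<le> (\<Sum>u<i. layer_bound m j)"
      unfolding E_def by (intro sum_mono) auto
    then show ?thesis by simp
  qed
  have dom: "rank_sums_dominate m" using m by (rule rank_sums_dominate)
  have C_le: "0 \<le> C i j" if "i \<le> j" "j \<le> m" for i j
  proof -
    have "E i j \<le> rank_sum m i j"
      using E[OF that] dom that unfolding rank_sums_dominate_def by (meson order.trans)
    then show ?thesis by (simp add: C)
  qed
  have C_sym: "C i j = C j i" if "i \<le> m" "j \<le> m" for i j
    unfolding C_def c_def
    by (subst sum.swap, intro sum.cong refl) (use that sym in \<open>auto simp: rank_dist_commute\<close>)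
  have C0: "0 \<le> C i j" if "i \<le> m" "j \<le> m" for i j
    using C_le[of i j] C_le[of j i] C_sym[OF that] that by (cases "i \<le> j") auto
  have diff: "F - f = (\<Sum>i<m. \<Sum>j<m. (X i - X (Suc i)) * (X j - X (Suc j)) * C (Suc i) (Suc j))"
  proof -
    have "F - f = (\<Sum>u<m. \<Sum>v<m. c u v * X u * X v)"
      by (simp add: F_def f_def c_def sum_subtractf left_diff_distrib)
    then show ?thesis unfolding C_def by (simp only: summation_by_parts_double[of X m c, OF X0])
  qed
  have nonneg: "0 \<le> (X i - X (Suc i)) * (X j - X (Suc j)) * C (Suc i) (Suc j)" if "i < m" "j < m" for i j
    using that dec[of i] dec[of j] C0[of "Suc i" "Suc j"] by (intro mult_nonneg_nonneg) auto
  then show "f \<le> F"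
    using diff sum_nonneg[of "{..<m}"] by (smt (verit) lessThan_iff sum_nonneg)
  assume "5 \<le> m"
  then have "E m m < rank_sum m m m"
    using E[of m m] dom unfolding rank_sums_dominate_def by (meson order.strict_trans1 order.refl)
  then have "0 < (X (m - 1) - X (Suc (m - 1))) * (X (m - 1) - X (Suc (m - 1))) * C (Suc (m - 1)) (Suc (m - 1))"
    using X0 pos m by (simp add: C)
  also have "\<dots> \<le> (\<Sum>j<m. (X (m - 1) - X (Suc (m - 1))) * (X j - X (Suc j)) * C (Suc (m - 1)) (Suc j))"
    by (intro member_le_sum nonneg) (use m in auto)
  also have "\<dots> \<le> (\<Sum>i<m. \<Sum>j<m. (X i - X (Suc i)) * (X j - X (Suc j)) * C (Suc i) (Suc j))"
    by (rule member_le_sum[of "m - 1" _ "\<lambda>i. \<Sum>j<m. (X i - X (Suc i)) * (X j - X (Suc j)) * C (Suc i) (Suc j)"])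
      (use nonneg m in \<open>auto intro: sum_nonneg\<close>)
  finally show "f < F" using diff by linarith
qed

lemma kite_form_rank_order:
  assumes "length us = m"
  defines "vs \<equiv> map (\<lambda>p. us ! inv_into {..<m} (rank_pos m) p) [0..<m]"
  shows "kite_form (map x vs) = (\<Sum>u<m. \<Sum>v<m. real (rank_dist m u v) * x (us ! u) * x (us ! v))"
    and "distinct us \<Longrightarrow> distinct vs" and "set vs = set us" and "length vs = m"
proof -
  let ?i = "inv_into {..<m} (rank_pos m)"
  have bij: "bij_betw ?i {..<m} {..<m}" using rank_pos_bij by (rule bij_betw_inv_into)
  have inv: "?i (rank_pos m u) = u" if "u < m" for u
    using rank_pos_inj that by (auto intro: inv_into_f_f)
  have "kite_form (map x vs) =
      (\<Sum>p<m. \<Sum>q<m. real (kite_dist p q) * x (us ! ?i p) * x (us ! ?i q))"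
    by (simp add: kite_form_def vs_def)
  also have "\<dots> = (\<Sum>u<m. \<Sum>q<m. real (kite_dist (rank_pos m u) q) * x (us ! u) * x (us ! ?i q))"
    by (subst sum.reindex_bij_betw[OF rank_pos_bij, symmetric]) (simp add: inv)
  also have "\<dots> = (\<Sum>u<m. \<Sum>v<m. real (rank_dist m u v) * x (us ! u) * x (us ! v))"
    unfolding rank_dist_def
    by (subst sum.reindex_bij_betw[OF rank_pos_bij, symmetric]) (simp add: inv)
  finally show "kite_form (map x vs) = (\<Sum>u<m. \<Sum>v<m. real (rank_dist m u v) * x (us ! u) * x (us ! v))" .
  show "length vs = m" by (simp add: vs_def)
  have "set vs = (!) us ` ?i ` {..<m}" by (auto simp: vs_def)
  also have "?i ` {..<m} = {..<m}" using bij by (simp add: bij_betw_def)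
  also have "(!) us ` {..<m} = set us" using assms(1) by (auto simp: set_conv_nth)
  finally show "set vs = set us" .
  show "distinct vs" if "distinct us"
  proof -
    have "inj_on (\<lambda>p. us ! ?i p) {..<m}"
      using comp_inj_on[of ?i "{..<m}" "(!) us"] bij that assms(1)
      by (simp add: bij_betw_def inj_on_nth comp_def)
    then show ?thesis by (simp add: vs_def distinct_map atLeast0LessThan)
  qed
qed

lemma kite_dominated_layered:
  assumes fin: "finite S" and card: "4 \<le> card S"
    and self: "\<And>u. u \<in> S \<Longrightarrow> d u u = 0"
    and ge_one: "\<And>u v. u \<in> S \<Longrightarrow> v \<in> S \<Longrightarrow> u \<noteq> v \<Longrightarrow> 1 \<le> d u v"
    and sym: "\<And>u v. u \<in> S \<Longrightarrow> v \<in> S \<Longrightarrow> d u v = d v u"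
    and layers: "\<And>u k. u \<in> S \<Longrightarrow> 2 \<le> k \<Longrightarrow> card {v \<in> S. k \<le> d u v} \<le> card S - 2 * k"
  shows "kite_dominated d S"
  unfolding kite_dominated_def
proof (intro allI impI)
  fix x :: "'a \<Rightarrow> real" assume pos: "\<forall>u\<in>S. 0 < x u"
  define m where "m = card S"
  obtain us0 where us0: "set us0 = S" "distinct us0" using finite_distinct_list[OF fin] by blast
  define us where "us = rev (sort_key x us0)"
  have us: "set us = S" "distinct us" "length us = m" "sorted (map x (rev us))"
    using us0 distinct_card[of us0] by (simp_all add: us_def m_def)
  \<comment> \<open>Padding with 0 keeps \<open>X\<close> decreasing and supplies the vanishing
    boundary value.\<close>
  define X where "X u = (if u < m then x (us ! u) else 0)" for u
  define e where "e u v = d (us ! u) (us ! v)" for u v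
  have in_S: "us ! u \<in> S" if "u < m" for u using that us by auto
  have us_bij: "bij_betw ((!) us) {..<m} S"
    using us by (auto intro!: bij_betw_nth)
  have "f \<le> F \<and> (5 \<le> m \<longrightarrow> f < F)"
    if "f = (\<Sum>u<m. \<Sum>v<m. real (e u v) * X u * X v)"
      "F = (\<Sum>u<m. \<Sum>v<m. real (rank_dist m u v) * X u * X v)" for f F
  proof -
    have 1: "card {v \<in> {..<m}. k \<le> e u v} \<le> m - 2 * k" if "u < m" "2 \<le> k" for u k
    proof -
      have "bij_betw ((!) us) {v \<in> {..<m}. k \<le> e u v} {v \<in> S. k \<le> d (us ! u) v}"
        using us_bij unfolding bij_betw_def e_def by (auto simp: inj_on_def)
      then show ?thesis using layers[OF in_S[OF that(1)] that(2)] by (simp add: bij_betw_same_card m_def)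
    qed
    have 2: "X (Suc u) \<le> X u" if "u < m" for u
    proof (cases "Suc u < m")
      case True
      then have "m - Suc (Suc u) \<le> m - Suc u" "m - Suc u < length (rev us)" using us by auto
      then have "x (rev us ! (m - Suc (Suc u))) \<le> x (rev us ! (m - Suc u))"
        using sorted_nth_mono[OF us(4), of "m - Suc (Suc u)" "m - Suc u"] by simp
      then show ?thesis using True us(3) by (simp add: X_def rev_nth)
    next
      case False
      then show ?thesis using that pos in_S[of u] by (simp add: X_def less_imp_le)
    qed
    have "0 < X (m - 1)" using pos in_S[of "m - 1"] card by (simp add: X_def m_def)
    moreover have "e u u = 0" if "u < m" for u
      using that in_S self by (simp add: e_def)
    moreover have "e u v = e v u" if "u < m" "v < m" for u v
      unfolding e_def using that in_S sym by blast
    moreover have "X m = 0" by (simp add: X_def)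
    ultimately show ?thesis
      unfolding that using rank_form_ge[of m e X] card 1 2 by (simp add: m_def)
  qed
  note form = this[OF refl refl]
  define vs where "vs = map (\<lambda>p. us ! inv_into {..<m} (rank_pos m) p) [0..<m]"
  note vs = kite_form_rank_order[OF us(3), folded vs_def]
  have F: "kite_form (map x vs) = (\<Sum>u<m. \<Sum>v<m. real (rank_dist m u v) * X u * X v)"
    unfolding vs(1) by (intro sum.cong) (auto simp: X_def)
  have f: "dist_form d S x = (\<Sum>u<m. \<Sum>v<m. real (e u v) * X u * X v)"
    unfolding dist_form_def sum.reindex_bij_betw[OF us_bij, symmetric]
    by (intro sum.cong) (auto simp: X_def e_def)
  have vs_S: "distinct vs" "set vs = S" using vs us by auto
  show "\<exists>vs. distinct vs \<and> set vs = S \<and> (dist_form d S x < kite_form (map x vs) \<or>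
      dist_form d S x \<le> kite_form (map x vs) \<and>
      (\<forall>i<length vs. \<forall>j<length vs. d (vs ! i) (vs ! j) = kite_dist i j))"
  proof (cases "5 \<le> m")
    case True
    then show ?thesis using form vs_S by (intro exI[of _ vs]) (simp add: f F)
  next
    case False
    then have m4: "m = 4" using card by (simp add: m_def)
    \<comment> \<open>With four vertices the cap for \<open>k = 2\<close> is 0, so all distances are
      1 and any order exhibits a kite.\<close>
    have "d (vs ! i) (vs ! j) = kite_dist i j" if ij: "i < 4" "j < 4" for i j
    proof -
      have S: "vs ! i \<in> S" "vs ! j \<in> S"
        unfolding vs_S(2)[symmetric] using ij vs(4) m4 by (auto intro: nth_mem)
      have "card {v \<in> S. 2 \<le> d (vs ! i) v} = 0"
        using layers[OF S(1), of 2] m4 by (simp add: m_def)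
      then have "\<not> 2 \<le> d (vs ! i) (vs ! j)" using S fin by auto
      moreover have "vs ! i = vs ! j \<longleftrightarrow> i = j"
        using vs_S(1) ij vs(4) m4 by (simp add: nth_eq_iff_index_eq)
      moreover have "kite_dist i j = (if i = j then 0 else 1)"
        using ij by (auto simp: kite_dist_def)
      ultimately show ?thesis
        using self[OF S(1)] ge_one[OF S] by (cases "i = j") auto
    qed
    then show ?thesis using form vs_S vs(4) m4 by (intro exI[of _ vs]) (simp add: f F)
  qed
qed

section \<open>Distances in graphs that are not 3-colourable\<close>

locale connected_pair_graph = pair_graph G for G :: "'a pair_pre_digraph" +
  assumes connected: "Digraph_Component.connected (with_proj G)"
begin

lemma ex_awalk:
  assumes "u \<in> pverts G" "v \<in> pverts G"
  shows "\<exists>p. awalk u p v"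
proof -
  have "u \<rightarrow>\<^sup>*\<^bsub>mk_symmetric (with_proj G)\<^esub> v"
    using connected assms unfolding Digraph_Component.connected_def strongly_connected_def by simp
  then have "u \<rightarrow>\<^sup>*\<^bsub>with_proj G\<^esub> v"
    by (simp only: reachable_mk_symmetric_eq[OF pair_sym_arcs])
  then show ?thesis by (simp only: reachable_awalk)
qed

text \<open>\<open>graph_dist\<close> minimises over paths without repeated vertices. Since cutting
  cycles out of a walk never lengthens it, later estimates may use arbitrary walks.\<close>

lemma length_awalk_to_apath_le: "awalk u p v \<Longrightarrow> length (awalk_to_apath p) \<le> length p"
proof (induct rule: awalk_to_apath_induct)
  case (path p)
  then have "awalk_to_apath p = p" by (auto simp: awalk_to_apath.simps)
  then show ?case by simp
next
  case (decomp p q r s)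
  then have "is_awalk_cyc_decomp p (q, r, s)"
    using awalk_cyc_decomp_has_prop[OF decomp(1)] by simp
  then have "p = q @ r @ s" by simp
  then show ?case
    using decomp(4) step_awalk_to_apath[OF decomp(1,2,3)] by simp
qed

lemma graph_dist_le_length: "awalk u p v \<Longrightarrow> graph_dist G u v \<le> length p"
proof -
  assume p: "awalk u p v"
  then have "apath u (awalk_to_apath p) v" by (rule apath_awalk_to_apath)
  then have "\<exists>q. apath u q v \<and> length q = length (awalk_to_apath p)" by (intro exI conjI) (assumption | rule refl)+
  then have "graph_dist G u v \<le> length (awalk_to_apath p)"
    unfolding graph_dist_def by (rule Least_le)
  then show ?thesis using length_awalk_to_apath_le[OF p] by (rule order.trans)
qed

lemma ex_awalk_length_graph_dist:
  assumes "u \<in> pverts G" "v \<in> pverts G"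
  shows "\<exists>p. awalk u p v \<and> length p = graph_dist G u v"
proof -
  obtain p where "awalk u p v" using ex_awalk[OF assms] by blast
  then have "apath u (awalk_to_apath p) v" by (rule apath_awalk_to_apath)
  then have "\<exists>k p. apath u p v \<and> length p = k" by (intro exI conjI) (assumption | rule refl)+
  from LeastI_ex[OF this] obtain q where "apath u q v" "length q = graph_dist G u v"
    unfolding graph_dist_def[symmetric] by (elim exE conjE)
  then show ?thesis by (intro exI[of _ q] conjI awalkI_apath)
qed

lemma graph_dist_self: "u \<in> pverts G \<Longrightarrow> graph_dist G u u = 0"
  using graph_dist_le_length[of u "[]" u] by (simp add: awalk_Nil_iff)

lemma graph_dist_commute_le:
  assumes "u \<in> pverts G" "v \<in> pverts G"
  shows "graph_dist G v u \<le> graph_dist G u v"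
proof -
  obtain p where p: "awalk u p v" "length p = graph_dist G u v"
    using ex_awalk_length_graph_dist[OF assms] by blast
  have "length (rev_path p) = length p" by (induction p) auto
  then show ?thesis using graph_dist_le_length[of v "rev_path p" u] p by simp
qed

lemma graph_dist_commute:
  "u \<in> pverts G \<Longrightarrow> v \<in> pverts G \<Longrightarrow> graph_dist G u v = graph_dist G v u"
  by (intro order.antisym graph_dist_commute_le)

lemma graph_dist_Suc:
  assumes "u \<in> pverts G" "(v, w) \<in> parcs G"
  shows "graph_dist G u w \<le> Suc (graph_dist G u v)"
proof -
  obtain p where p: "awalk u p v" "length p = graph_dist G u v"
    using ex_awalk_length_graph_dist[OF assms(1)] assms(2) in_arcsD1 by blast
  have "awalk v [(v, w)] w" using assms(2) in_arcsD2 in_arcsD1 by (simp add: awalk_simps)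
  then have "awalk u (p @ [(v, w)]) w" using p(1) by simp
  from graph_dist_le_length[OF this] show ?thesis using p(2) by simp
qed

lemma graph_dist_eq_0_iff:
  assumes "u \<in> pverts G" "v \<in> pverts G"
  shows "graph_dist G u v = 0 \<longleftrightarrow> u = v"
  using ex_awalk_length_graph_dist[OF assms] graph_dist_self[of u] assms
  by (auto simp: awalk_Nil_iff)

lemma graph_dist_eq_1_iff:
  assumes "u \<in> pverts G" "v \<in> pverts G"
  shows "graph_dist G u v = 1 \<longleftrightarrow> (u, v) \<in> parcs G"
proof
  assume "graph_dist G u v = 1"
  then obtain p where "awalk u p v" "length p = 1"
    using ex_awalk_length_graph_dist[OF assms] by auto
  then show "(u, v) \<in> parcs G"
    by (auto simp: length_Suc_conv awalk_simps)
next
  assume *: "(u, v) \<in> parcs G"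
  then have "u \<noteq> v" using pair_no_loops[of "(u, v)"] by auto
  then show "graph_dist G u v = 1"
    using graph_dist_Suc[OF assms(1) *] graph_dist_eq_0_iff[OF assms] graph_dist_self[OF assms(1)]
    by simp
qed

lemma ex_arc_leaving:
  assumes "u \<in> U" "v \<notin> U" "u \<in> pverts G" "v \<in> pverts G"
  shows "\<exists>a b. (a, b) \<in> parcs G \<and> a \<in> U \<and> b \<notin> U"
proof -
  obtain p where "awalk u p v" using ex_awalk assms by blast
  then show ?thesis using assms(1,2)
  proof (induction p arbitrary: u)
    case Nil
    then show ?case by (simp add: awalk_Nil_iff)
  next
    case (Cons e p)
    then have e: "e \<in> parcs G" "fst e = u" "awalk (snd e) p v" by (simp_all add: awalk_simps)
    show ?case
    proof (cases "snd e \<in> U")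
      case True
      then show ?thesis by (rule Cons.IH[OF e(3) _ Cons.prems(3)])
    next
      case False
      moreover have "(u, snd e) \<in> parcs G" using e(1,2) by auto
      ultimately show ?thesis using Cons.prems(2) by blast
    qed
  qed
qed

end

section \<open>Vertex sets critical for three colours\<close>

text \<open>Relativising the condition to \<open>S\<close> takes the place of an induced subgraph,
  so that distances between vertices of \<open>S\<close> remain those of \<open>G\<close>.\<close>

definition colorable_on :: "'a pair_pre_digraph \<Rightarrow> 'a set \<Rightarrow> nat \<Rightarrow> bool" where
  "colorable_on G S k \<longleftrightarrow>
     (\<exists>c :: 'a \<Rightarrow> nat. (\<forall>v\<in>S. c v < k) \<and> (\<forall>(u, v)\<in>parcs G. u \<in> S \<longrightarrow> v \<in> S \<longrightarrow> c u \<noteq> c v))"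

lemma (in pair_wf_digraph) colorable_on_pverts: "colorable_on G (pverts G) k \<longleftrightarrow> colorable G k"
  unfolding colorable_on_def colorable_def using in_arcsD1 in_arcsD2
  by (intro ex_cong conj_cong refl) blast

locale critical_set = connected_pair_graph +
  fixes S :: "'a set"
  assumes S_sub: "S \<subseteq> pverts G"
    and not_colorable: "\<not> colorable_on G S 3"
    and critical: "\<And>T. T \<subset> S \<Longrightarrow> colorable_on G T 3"
begin

lemma finite_S: "finite S"
  using S_sub pair_finite_verts by (rule finite_subset)

text \<open>With fewer than three neighbours in \<open>S\<close>, a colouring of the other vertices
  would leave one of three colours free for \<open>u\<close>.\<close>

lemma degree_ge_three:
  assumes "u \<in> S"
  shows "3 \<le> card {v \<in> S. (u, v) \<in> parcs G}"
proof (rule ccontr)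
  let ?N = "{v \<in> S. (u, v) \<in> parcs G}"
  assume less: "\<not> ?thesis"
  have "S - {u} \<subset> S" using assms by auto
  from critical[OF this] obtain c :: "'a \<Rightarrow> nat" where c: "\<forall>v\<in>S - {u}. c v < 3"
    "\<forall>(a, b)\<in>parcs G. a \<in> S - {u} \<longrightarrow> b \<in> S - {u} \<longrightarrow> c a \<noteq> c b"
    unfolding colorable_on_def by auto
  have "card (c ` ?N) < card {..<3::nat}"
    using card_image_le[of ?N c] less finite_S by simp
  then have "\<not> {..<3} \<subseteq> c ` ?N"
    using card_mono[of "c ` ?N" "{..<3}"] finite_S by auto
  then obtain k where k: "k < 3" "k \<notin> c ` ?N" by auto
  have "colorable_on G S 3"
    unfolding colorable_on_def
  proof (intro exI[of _ "c(u := k)"] conjI ballI)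
    show "(c(u := k)) v < 3" if "v \<in> S" for v using that c(1) k(1) by auto
    fix e assume e: "e \<in> parcs G"
    obtain a b where ab: "e = (a, b)" by (cases e)
    have "a \<noteq> b" "(b, a) \<in> parcs G"
      using pair_no_loops[OF e] arcs_symmetric e by (auto simp: ab)
    then show "case e of (a, b) \<Rightarrow> a \<in> S \<longrightarrow> b \<in> S \<longrightarrow> (c(u := k)) a \<noteq> (c(u := k)) b"
      using c(2) k(2) e by (auto simp: ab)
  qed
  with not_colorable show False ..
qed

text \<open>
  If a sphere around \<open>u\<close> met \<open>S\<close> in at most one vertex \<open>z\<close>, colourings of the two sides could be
  glued after a permutation of colours that makes them agree at \<open>z\<close>.
\<close>

lemma sphere_ge_two:
  assumes u: "u \<in> S" and w: "w \<in> S" "k < graph_dist G u w" and k: "1 \<le> k"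
  shows "2 \<le> card {v \<in> S. graph_dist G u v = k}"
proof (rule ccontr)
  assume "\<not> ?thesis"
  then have "card {v \<in> S. graph_dist G u v = k} \<le> Suc 0" by simp
  then have "\<forall>x\<in>{v \<in> S. graph_dist G u v = k}. \<forall>y\<in>{v \<in> S. graph_dist G u v = k}. x = y"
    using finite_S by (subst (asm) card_le_Suc0_iff_eq) simp_all
  then obtain z where z: "{v \<in> S. graph_dist G u v = k} \<subseteq> {z}"
    by (cases "{v \<in> S. graph_dist G u v = k} = {}") blast+
  define A where "A = {v \<in> S. graph_dist G u v \<le> k}"
  define B where "B = {v \<in> S. k \<le> graph_dist G u v}"
  have "w \<notin> A" "A \<subseteq> S" using w(2) by (auto simp: A_def)
  then have "A \<subset> S" using w(1) by blast
  from critical[OF this] obtain a :: "'a \<Rightarrow> nat" where a: "\<forall>v\<in>A. a v < 3"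
    "\<forall>(x, y)\<in>parcs G. x \<in> A \<longrightarrow> y \<in> A \<longrightarrow> a x \<noteq> a y" unfolding colorable_on_def by auto
  have "u \<notin> B" using u S_sub k by (auto simp: B_def graph_dist_self)
  moreover have "B \<subseteq> S" by (auto simp: B_def)
  ultimately have "B \<subset> S" using u by blast
  from critical[OF this] obtain b :: "'a \<Rightarrow> nat" where b: "\<forall>v\<in>B. b v < 3"
    "\<forall>(x, y)\<in>parcs G. x \<in> B \<longrightarrow> y \<in> B \<longrightarrow> b x \<noteq> b y" unfolding colorable_on_def by auto
  \<comment> \<open>A transposition of colours that carries \<open>b z\<close> to
    \<open>a z\<close>.\<close>
  define s where "s t = (if t = b z then a z else if t = a z then b z else t)" for t
  have s: "s x = s y \<longleftrightarrow> x = y" for x y by (auto simp: s_def)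
  have sz: "s (b z) = a z" by (simp add: s_def)
  \<comment> \<open>If \<open>z\<close> is not a vertex of \<open>S\<close> on the sphere, the
    sphere misses \<open>S\<close> and no arc inside \<open>S\<close> crosses it. Then
    \<open>b\<close> stays as it is, since \<open>a z\<close> and \<open>b z\<close> need not be
    among the three colours.\<close>
  define c where "c v = (if z \<in> S \<and> graph_dist G u z = k then
      if graph_dist G u v \<le> k then a v else s (b v)
    else if graph_dist G u v \<le> k then a v else b v)" for v
  have "colorable_on G S 3"
    unfolding colorable_on_def
  proof (intro exI[of _ c] conjI ballI)
    show "c v < 3" if "v \<in> S" for v
    proof -
      have "s (b v) < 3" if "z \<in> S" "graph_dist G u z = k" "k \<le> graph_dist G u v"
        using that \<open>v \<in> S\<close> a(1) b(1) by (simp add: s_def A_def B_def)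
      then show ?thesis using \<open>v \<in> S\<close> a(1) b(1) by (simp add: c_def A_def B_def)
    qed
    have cross: "c x \<noteq> c y" if xy: "(x, y) \<in> parcs G" "x \<in> S" "y \<in> S"
      "graph_dist G u x \<le> k" "k < graph_dist G u y" for x y
    proof -
      \<comment> \<open>The distance from \<open>u\<close> changes by at most 1 along an arc, so a
        crossing arc starts on the sphere, that is, at \<open>z\<close>.\<close>
      have "graph_dist G u y \<le> Suc (graph_dist G u x)"
        using graph_dist_Suc xy(1) u S_sub by blast
      then have x: "graph_dist G u x = k" using xy by simp
      then have "x = z" using z xy by auto
      have "b x \<noteq> b y" using b(2) xy x by (auto simp: B_def)
      then show ?thesis
        using xy x sz s[of "b x" "b y"] unfolding c_def \<open>x = z\<close> by simp
    qed
    fix e assume e: "e \<in> parcs G"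
    obtain x y where xy: "e = (x, y)" by (cases e)
    have "c x \<noteq> c y" if S: "x \<in> S" "y \<in> S"
    proof -
      consider "graph_dist G u x \<le> k" "graph_dist G u y \<le> k"
        | "graph_dist G u x \<le> k" "k < graph_dist G u y"
        | "k < graph_dist G u x" "graph_dist G u y \<le> k"
        | "k < graph_dist G u x" "k < graph_dist G u y" by linarith
      then show ?thesis
      proof cases
        case 1
        then have "a x \<noteq> a y" using a(2) e S by (auto simp: xy A_def)
        then show ?thesis using 1 by (simp add: c_def)
      next
        case 2
        then show ?thesis using cross e S by (simp add: xy)
      next
        case 3
        then show ?thesis using cross[of y x] arcs_symmetric e S by (auto simp: xy)
      next
        case 4
        then have "b x \<noteq> b y" using b(2) e S by (auto simp: xy B_def)
        then show ?thesis using 4 s[of "b x" "b y"] by (simp add: c_def)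
      qed
    qed
    then show "case e of (x, y) \<Rightarrow> x \<in> S \<longrightarrow> y \<in> S \<longrightarrow> c x \<noteq> c y" by (simp add: xy)
  qed
  with not_colorable show False ..
qed

text \<open>The count starts with \<open>u\<close> and three neighbours, \<open>4 = 2 * 2\<close>,
  and each sphere from radius 2 up to \<open>k - 1\<close> contributes two more, because
  \<open>w\<close> lies beyond it.\<close>

lemma card_ball_ge:
  assumes u: "u \<in> S" and "2 \<le> k" "w \<in> S" "k \<le> graph_dist G u w"
  shows "2 * k \<le> card {v \<in> S. graph_dist G u v < k}"
  using assms(2,4)
proof (induction k rule: dec_induct)
  case base
  let ?N = "{v \<in> S. (u, v) \<in> parcs G}"
  have "u \<notin> ?N" using pair_no_loops[of "(u, u)"] by auto
  then have "4 \<le> card (insert u ?N)"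
    using degree_ge_three[OF u] finite_S by simp
  also have "\<dots> \<le> card {v \<in> S. graph_dist G u v < 2}"
  proof (intro card_mono)
    have "graph_dist G u x = 1" if "x \<in> ?N" for x
      using that graph_dist_eq_1_iff u S_sub by blast
    moreover have "graph_dist G u u = 0" using graph_dist_self u S_sub by blast
    ultimately show "insert u ?N \<subseteq> {v \<in> S. graph_dist G u v < 2}"
      using u by auto
  qed (simp add: finite_S)
  finally show ?case by simp
next
  case (step k)
  have "{v \<in> S. graph_dist G u v < Suc k} =
      {v \<in> S. graph_dist G u v < k} \<union> {v \<in> S. graph_dist G u v = k}" by auto
  moreover have "card \<dots> = card {v \<in> S. graph_dist G u v < k} + card {v \<in> S. graph_dist G u v = k}"
    by (intro card_Un_disjoint) (auto simp: finite_S)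
  moreover have "2 \<le> card {v \<in> S. graph_dist G u v = k}"
    using step assms(3) by (intro sphere_ge_two[OF u assms(3)]) auto
  ultimately show ?case using step by simp
qed

lemma card_far_le:
  assumes u: "u \<in> S" and k: "2 \<le> k"
  shows "card {v \<in> S. k \<le> graph_dist G u v} \<le> card S - 2 * k"
proof (cases "{v \<in> S. k \<le> graph_dist G u v} = {}")
  case True
  show ?thesis unfolding True by simp
next
  case False
  then obtain w where "w \<in> S" "k \<le> graph_dist G u w" by auto
  from card_ball_ge[OF u k this] have "2 * k \<le> card {v \<in> S. graph_dist G u v < k}" .
  moreover have "card ({v \<in> S. graph_dist G u v < k} \<union> {v \<in> S. k \<le> graph_dist G u v}) =
      card {v \<in> S. graph_dist G u v < k} + card {v \<in> S. k \<le> graph_dist G u v}"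
    by (rule card_Un_disjoint) (auto simp: finite_S)
  moreover have "{v \<in> S. graph_dist G u v < k} \<union> {v \<in> S. k \<le> graph_dist G u v} = S"
    by auto
  ultimately show ?thesis by simp
qed

lemma card_S_ge: "4 \<le> card S"
proof -
  have "S \<noteq> {}" using not_colorable by (auto simp: colorable_on_def)
  then obtain u where u: "u \<in> S" by auto
  have "u \<notin> {v \<in> S. (u, v) \<in> parcs G}" using pair_no_loops[of "(u, u)"] by auto
  then have "4 \<le> card (insert u {v \<in> S. (u, v) \<in> parcs G})"
    using degree_ge_three[OF u] finite_S by simp
  also have "\<dots> \<le> card S" using u by (intro card_mono finite_S) auto
  finally show ?thesis .
qed

lemma kite_dominated_critical: "kite_dominated (graph_dist G) S"
proof (rule kite_dominated_layered)
  show "1 \<le> graph_dist G u v" if "u \<in> S" "v \<in> S" "u \<noteq> v" for u v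
  proof -
    have "graph_dist G u v \<noteq> 0" using graph_dist_eq_0_iff that S_sub by blast
    then show ?thesis by simp
  qed
  show "graph_dist G u v = graph_dist G v u" if "u \<in> S" "v \<in> S" for u v
    using graph_dist_commute that S_sub by blast
  show "graph_dist G u u = 0" if "u \<in> S" for u
    using graph_dist_self that S_sub by blast
qed (rule finite_S card_S_ge card_far_le; assumption)+

text \<open>Connectedness supplies an arc from \<open>U\<close> to a vertex outside; distances from
  that vertex exceed those from its neighbour by at most 1, which is what an insertion
  requires.\<close>

lemma kite_dominated_superset:
  assumes "S \<subseteq> U" "U \<subseteq> pverts G" "kite_dominated (graph_dist G) U"
  shows "kite_dominated (graph_dist G) (pverts G)"
  using assms
proof (induction "card (pverts G - U)" arbitrary: U rule: less_induct)
  case less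
  show ?case
  proof (cases "U = pverts G")
    case True
    then show ?thesis using less.prems(3) by simp
  next
    case False
    then have "\<not> pverts G \<subseteq> U" using less.prems(2) by simp
    then obtain v where v: "v \<in> pverts G" "v \<notin> U" unfolding subset_iff by metis
    have "S \<noteq> {}" using card_S_ge by (rule contrapos_pn) simp
    then obtain u where u: "u \<in> U" using less.prems(1) by blast
    obtain a b where ab: "(a, b) \<in> parcs G" "a \<in> U" "b \<notin> U"
      using ex_arc_leaving[OF u v(2) subsetD[OF less.prems(2) u] v(1)] by blast
    have b: "b \<in> pverts G" using ab(1) by (rule in_arcsD2)
    have sub: "insert b U \<subseteq> pverts G" using b less.prems(2) by simp
    have finU: "finite U" using less.prems(2) pair_finite_verts by (rule finite_subset)
    have "kite_dominated (graph_dist G) (insert b U)"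
    proof (rule kite_dominated_insert[OF finU _ ab(2,3)])
      show "4 \<le> card U" using card_S_ge card_mono[OF finU less.prems(1)] by (rule order.trans)
      show "graph_dist G w w = 0" if "w \<in> insert b U" for w
        by (rule graph_dist_self[OF subsetD[OF sub that]])
      show "graph_dist G w z = graph_dist G z w" if "w \<in> insert b U" "z \<in> insert b U" for w z
        by (rule graph_dist_commute[OF subsetD[OF sub that(1)] subsetD[OF sub that(2)]])
      show "graph_dist G b w \<le> Suc (graph_dist G a w)" if "w \<in> U" for w
      proof -
        have w: "w \<in> pverts G" "a \<in> pverts G" using that ab(2) less.prems(2) by auto
        show ?thesis
          using graph_dist_Suc[OF w(1) ab(1)] graph_dist_commute[OF w(1) b]
            graph_dist_commute[OF w(1,2)] by simp
      qed
    qed (rule less.prems(3))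
    moreover have "card (pverts G - insert b U) < card (pverts G - U)"
      using b ab(3) pair_finite_verts by (intro psubset_card_mono) auto
    ultimately show ?thesis
      using less.hyps[of "insert b U"] sub less.prems(1) by auto
  qed
qed

end

theorem (in connected_pair_graph) kite_dominated_if_not_3_colorable:
  assumes "\<not> colorable G 3"
  shows "kite_dominated (graph_dist G) (pverts G)"
proof -
  let ?P = "\<lambda>S. S \<subseteq> pverts G \<and> \<not> colorable_on G S 3"
  have "?P (pverts G)" using assms by (simp add: colorable_on_pverts)
  from ex_has_least_nat[of ?P, OF this, of card]
  obtain S where S: "?P S" "\<forall>T. ?P T \<longrightarrow> card S \<le> card T" by blast
  interpret critical_set G S
  proof
    show "colorable_on G T 3" if "T \<subset> S" for T
    proof -
      have "card T < card S"
        using that S(1) pair_finite_verts by (meson finite_subset psubset_card_mono)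
      then have "\<not> ?P T" using S(2) not_le by blast
      then show ?thesis using S(1) that by blast
    qed
  qed (use S(1) in auto)
  show ?thesis
    using kite_dominated_superset[OF _ S_sub kite_dominated_critical] by simp
qed

section \<open>The distance spectral radius\<close>

text \<open>An instance of Tychonoff. Weight vectors are functions on the whole type, possibly
  infinite; bounds equal to 0 outside the vertex set will cut the unit sphere down to a compact
  set.\<close>

lemma compact_product_cube:
  fixes a b :: "'a \<Rightarrow> real"
  shows "compact {x. \<forall>i. a i \<le> x i \<and> x i \<le> b i}"
proof -
  have "compactin (product_topology (\<lambda>_. euclidean) UNIV) (PiE UNIV (\<lambda>i. {a i..b i}))"
    by (subst compactin_PiE) simp
  moreover have "PiE UNIV (\<lambda>i. {a i..b i}) = {x. \<forall>i. a i \<le> x i \<and> x i \<le> b i}"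
    by (auto simp: PiE_def Pi_def)
  ultimately show ?thesis by (simp add: euclidean_product_topology)
qed

lemma continuous_on_apply [continuous_intros]: "continuous_on A (\<lambda>x :: 'a \<Rightarrow> real. x i)"
  by (rule continuous_on_subset[OF continuous_on_product_coordinates]) simp

text \<open>First-order condition at a maximum: for small \<open>t\<close> a nonzero linear term
  would outweigh the quadratic one. The choice \<open>t = b / s\<close> is small enough because
  \<open>s\<close> exceeds \<open>c\<close>.\<close>

lemma linear_term_eq_0:
  fixes b c :: real
  assumes "\<And>t. 2 * t * b \<le> t\<^sup>2 * c"
  shows "b = 0"
proof (rule ccontr)
  assume b: "b \<noteq> 0"
  define s where "s = \<bar>c\<bar> + 1"
  have s: "0 < s" "c < s" by (auto simp: s_def)
  have "2 * (b / s) * b \<le> (b / s)\<^sup>2 * c" by (rule assms)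
  also have "\<dots> \<le> (b / s)\<^sup>2 * s" using s by (intro mult_left_mono) auto
  also have "\<dots> = b\<^sup>2 / s" using s by (simp add: power2_eq_square)
  finally have "2 * b\<^sup>2 / s \<le> b\<^sup>2 / s" by (simp add: power2_eq_square)
  then show False using s b by (simp add: field_simps)
qed

locale distance_form =
  fixes d :: "'a \<Rightarrow> 'a \<Rightarrow> nat" and V :: "'a set"
  assumes finite_V: "finite V" and card_V: "2 \<le> card V"
    and dist_self: "\<And>u. u \<in> V \<Longrightarrow> d u u = 0"
    and dist_pos: "\<And>u v. u \<in> V \<Longrightarrow> v \<in> V \<Longrightarrow> u \<noteq> v \<Longrightarrow> 1 \<le> d u v"
    and dist_sym: "\<And>u v. u \<in> V \<Longrightarrow> v \<in> V \<Longrightarrow> d u v = d v u"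
begin

definition sq_norm :: "('a \<Rightarrow> real) \<Rightarrow> real" where
  "sq_norm x = (\<Sum>u\<in>V. (x u)\<^sup>2)"

lemma sq_norm_nonneg: "0 \<le> sq_norm x"
  unfolding sq_norm_def by (intro sum_nonneg) simp

lemma sq_norm_eq_0: "sq_norm x = 0 \<Longrightarrow> u \<in> V \<Longrightarrow> x u = 0"
  unfolding sq_norm_def using finite_V by (simp add: sum_nonneg_eq_0_iff)

lemma sq_norm_scale: "sq_norm (\<lambda>u. c * x u) = c\<^sup>2 * sq_norm x"
  by (simp add: sq_norm_def power_mult_distrib sum_distrib_left)

lemma dist_form_scale: "dist_form d V (\<lambda>u. c * x u) = c\<^sup>2 * dist_form d V x"
  by (simp add: dist_form_def sum_distrib_left power2_eq_square mult_ac)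

lemma sq_norm_fun_upd:
  assumes "u \<in> V"
  shows "sq_norm (x(u := x u + t)) = sq_norm x + 2 * t * x u + t\<^sup>2"
proof -
  have "sq_norm y = (y u)\<^sup>2 + (\<Sum>v\<in>V - {u}. (y v)\<^sup>2)" for y
    unfolding sq_norm_def by (rule sum.remove[OF finite_V assms])
  moreover have "(\<Sum>v\<in>V - {u}. ((x(u := x u + t)) v)\<^sup>2) = (\<Sum>v\<in>V - {u}. (x v)\<^sup>2)"
    by (rule sum.cong) auto
  ultimately show ?thesis by (simp add: power2_sum)
qed

lemma ex_maximizer:
  "\<exists>x. sq_norm x = 1 \<and> (\<forall>y. sq_norm y = 1 \<longrightarrow> dist_form d V y \<le> dist_form d V x)"
proof -
  let ?b = "\<lambda>i. if i \<in> V then 1 else 0 :: real"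
  define K where "K = {x. \<forall>i. - ?b i \<le> x i \<and> x i \<le> ?b i} \<inter> {x. sq_norm x = 1}"
  have "continuous_on UNIV sq_norm"
    unfolding sq_norm_def by (intro continuous_intros)
  then have "closed {x. sq_norm x = 1}"
    by (rule closed_Collect_eq) (rule continuous_on_const)
  then have compact: "compact K"
    unfolding K_def by (intro compact_Int_closed compact_product_cube)
  have cont: "continuous_on K (dist_form d V)"
    unfolding dist_form_def by (intro continuous_intros)
  have restr: "(\<lambda>i. if i \<in> V then y i else 0) \<in> K" if "sq_norm y = 1" for y
  proof -
    have "(y i)\<^sup>2 \<le> 1" if "i \<in> V" for i
      using member_le_sum[of i V "\<lambda>u. (y u)\<^sup>2"] that finite_V \<open>sq_norm y = 1\<close>
      by (simp add: sq_norm_def)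
    then have "\<bar>y i\<bar> \<le> 1" if "i \<in> V" for i
      using that by (simp add: abs_square_le_1)
    moreover have "sq_norm (\<lambda>i. if i \<in> V then y i else 0) = sq_norm y"
      unfolding sq_norm_def by (rule sum.cong) auto
    ultimately show ?thesis using that by (auto simp: K_def abs_le_iff)
  qed
  obtain w where w: "w \<in> V" using card_V by fastforce
  have "sq_norm (\<lambda>i. if i = w then 1 else 0) = 1"
    unfolding sq_norm_def using w finite_V by (simp add: if_distrib[of "\<lambda>t. t\<^sup>2"] cong: if_cong)
  from restr[OF this] have "K \<noteq> {}" by auto
  from continuous_attains_sup[OF compact this cont]
  obtain x where x: "x \<in> K" "\<And>y. y \<in> K \<Longrightarrow> dist_form d V y \<le> dist_form d V x" by blast
  have "dist_form d V y \<le> dist_form d V x" if "sq_norm y = 1" for y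
  proof -
    have "dist_form d V (\<lambda>i. if i \<in> V then y i else 0) = dist_form d V y"
      unfolding dist_form_def by (intro sum.cong) auto
    then show ?thesis using x(2)[OF restr[OF that]] by simp
  qed
  then show ?thesis using x(1) unfolding K_def by blast
qed

text \<open>Absolute values do not decrease the form, so a maximiser on the unit sphere may be taken
  nonnegative. Perturbing one coordinate gives the eigenvalue equations. A zero coordinate would
  force all others to vanish, as the off-diagonal distances are positive.\<close>

lemma perron_vector:
  obtains x \<mu> where "\<And>u. u \<in> V \<Longrightarrow> 0 < x u"
    "\<And>u. u \<in> V \<Longrightarrow> (\<Sum>w\<in>V. real (d u w) * x w) = \<mu> * x u"
    "\<And>y. dist_form d V y \<le> \<mu> * sq_norm y" "dist_form d V x = \<mu> * sq_norm x"
proof -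
  obtain x0 where x0: "sq_norm x0 = 1" "\<And>y. sq_norm y = 1 \<Longrightarrow> dist_form d V y \<le> dist_form d V x0"
    using ex_maximizer by blast
  define x where "x u = \<bar>x0 u\<bar>" for u
  define \<mu> where "\<mu> = dist_form d V x"
  have x1: "sq_norm x = 1" using x0(1) by (simp add: sq_norm_def x_def)
  have "dist_form d V x0 \<le> dist_form d V x"
    unfolding dist_form_def
  proof (intro sum_mono)
    fix u v
    have "x0 u * x0 v \<le> x u * x v" unfolding x_def abs_mult[symmetric] by (rule abs_ge_self)
    then have "real (d u v) * (x0 u * x0 v) \<le> real (d u v) * (x u * x v)"
      by (intro mult_left_mono) simp_all
    then show "real (d u v) * x0 u * x0 v \<le> real (d u v) * x u * x v" by (simp only: mult.assoc)
  qed
  then have max1: "dist_form d V y \<le> \<mu>" if "sq_norm y = 1" for y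
    using x0(2)[OF that] by (simp add: \<mu>_def)
  have max: "dist_form d V y \<le> \<mu> * sq_norm y" for y
  proof (cases "sq_norm y = 0")
    case True
    have "real (d u v) * y u * y v = 0" if "u \<in> V" for u v
      using sq_norm_eq_0[OF True that] by simp
    then have "dist_form d V y = 0" unfolding dist_form_def by (intro sum.neutral ballI) simp
    then show ?thesis using True by simp
  next
    case False
    then have pos: "0 < sq_norm y" using sq_norm_nonneg[of y] by simp
    define c where "c = 1 / sqrt (sq_norm y)"
    have c: "c\<^sup>2 = 1 / sq_norm y" using pos by (simp add: c_def power_divide)
    have "dist_form d V (\<lambda>u. c * y u) \<le> \<mu>"
      using pos by (intro max1) (simp add: sq_norm_scale c)
    then show ?thesis using pos by (simp add: dist_form_scale c field_simps)
  qed
  have eig: "(\<Sum>w\<in>V. real (d u w) * x w) = \<mu> * x u" if u: "u \<in> V" for u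
  proof -
    have "2 * t * ((\<Sum>w\<in>V. real (d u w) * x w) - \<mu> * x u) \<le> t\<^sup>2 * \<mu>" for t
    proof -
      have "dist_form d V (x(u := x u + t)) = \<mu> + 2 * t * (\<Sum>w\<in>V. real (d u w) * x w)"
        unfolding \<mu>_def
        by (rule dist_form_fun_upd[where d = d]) (simp_all add: finite_V u dist_self dist_sym[of _ u])
      moreover have "dist_form d V (x(u := x u + t)) \<le> \<mu> * (1 + 2 * t * x u + t\<^sup>2)"
        using max[of "x(u := x u + t)"] by (simp only: sq_norm_fun_upd[OF u] x1)
      ultimately show ?thesis by (simp add: algebra_simps)
    qed
    from linear_term_eq_0[OF this] show ?thesis by simp
  qed
  have pos: "0 < x u" if u: "u \<in> V" for u
  proof (rule ccontr)
    assume "\<not> 0 < x u"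
    then have xu: "x u = 0" by (simp add: x_def)
    have x_nonneg: "0 \<le> x v" for v by (simp add: x_def)
    have sum0: "(\<Sum>w\<in>V. real (d u w) * x w) = 0" using eig[OF u] xu by simp
    have z: "real (d u w) * x w = 0" if "w \<in> V" for w
      by (rule sum_nonneg_0[OF finite_V _ sum0 that]) (simp add: x_nonneg)
    have "x w = 0" if "w \<in> V" for w
    proof (cases "w = u")
      case False
      then show ?thesis using z[OF that] dist_pos[OF u that] by simp
    qed (simp add: xu)
    then have "sq_norm x = 0" unfolding sq_norm_def by simp
    then show False using x1 by simp
  qed
  show thesis
    by (rule that[OF pos eig max]) (simp_all add: \<mu>_def x1)
qed

text \<open>Vectors indexed by the enumeration \<open>vs\<close> correspond to functions on \<open>V\<close>.\<close>

lemma eigenvalue_mat_iff: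
  assumes vs: "distinct vs" "set vs = V"
  shows "eigenvalue (Matrix.mat (length vs) (length vs) (\<lambda>(i, j). real (d (vs ! i) (vs ! j)))) k \<longleftrightarrow>
    (\<exists>x. (\<exists>u\<in>V. x u \<noteq> 0) \<and> (\<forall>u\<in>V. (\<Sum>w\<in>V. real (d u w) * x w) = k * x u))"
    (is "eigenvalue ?A k \<longleftrightarrow> ?R")
proof -
  let ?n = "length vs"
  have bij: "bij_betw ((!) vs) {..<?n} V"
    using vs by (auto intro!: bij_betw_nth)
  have mult: "vec_index (mult_mat_vec ?A (Matrix.vec ?n (\<lambda>i. x (vs ! i)))) i = (\<Sum>w\<in>V. real (d (vs ! i) w) * x w)"
    if "i < ?n" for i x
    using that sum.reindex_bij_betw[OF bij, of "\<lambda>w. real (d (vs ! i) w) * x w"]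
    by (simp add: scalar_prod_def atLeast0LessThan)
  have all: "(\<forall>u\<in>V. P u) \<longleftrightarrow> (\<forall>i<?n. P (vs ! i))" for P
    by (simp add: vs(2)[symmetric] all_set_conv_all_nth)
  have ev: "eigenvector ?A (Matrix.vec ?n (\<lambda>i. x (vs ! i))) k \<longleftrightarrow>
      (\<exists>u\<in>V. x u \<noteq> 0) \<and> (\<forall>u\<in>V. (\<Sum>w\<in>V. real (d u w) * x w) = k * x u)" for x
  proof -
    have 1: "Matrix.vec ?n (\<lambda>i. x (vs ! i)) = 0\<^sub>v ?n \<longleftrightarrow> (\<forall>u\<in>V. x u = 0)"
      unfolding all by (auto simp: vec_eq_iff)
    have 2: "mult_mat_vec ?A (Matrix.vec ?n (\<lambda>i. x (vs ! i))) = smult_vec k (Matrix.vec ?n (\<lambda>i. x (vs ! i)))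
        \<longleftrightarrow> (\<forall>u\<in>V. (\<Sum>w\<in>V. real (d u w) * x w) = k * x u)"
      unfolding all by (subst vec_eq_iff) (simp add: mult del: index_mult_mat_vec)
    have 3: "dim_row ?A = ?n" by simp
    show ?thesis unfolding eigenvector_def 3 1 2 by simp
  qed
  show ?thesis
  proof
    assume "eigenvalue ?A k"
    then obtain v where v: "eigenvector ?A v k" unfolding eigenvalue_def by blast
    define x where "x u = vec_index v (inv_into {..<?n} ((!) vs) u)" for u
    have dim: "dim_vec v = ?n" using v unfolding eigenvector_def by simp
    have "x (vs ! i) = vec_index v i" if "i < ?n" for i
      using that bij unfolding x_def bij_betw_def by (simp add: inv_into_f_f)
    then have "v = Matrix.vec ?n (\<lambda>i. x (vs ! i))" using dim by (intro eq_vecI) simp_all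
    with v have "eigenvector ?A (Matrix.vec ?n (\<lambda>i. x (vs ! i))) k" by (simp only:)
    then show ?R unfolding ev by blast
  next
    assume ?R
    then show "eigenvalue ?A k" unfolding ev[symmetric] eigenvalue_def by blast
  qed
qed

text \<open>An eigenvector \<open>y\<close> for \<open>k\<close> satisfies
  \<open>dist_form d V y = k * sq_norm y\<close>, so the Rayleigh bound makes the Perron value
  \<open>\<mu>\<close> the largest eigenvalue.\<close>

lemma Max_eigenvalue:
  assumes vs: "distinct vs" "set vs = V"
  obtains x where "\<And>u. u \<in> V \<Longrightarrow> 0 < x u"
    "dist_form d V x = Max {k. eigenvalue (Matrix.mat (length vs) (length vs) (\<lambda>(i, j). real (d (vs ! i) (vs ! j)))) k} * sq_norm x"
    "\<And>y. dist_form d V y \<le> Max {k. eigenvalue (Matrix.mat (length vs) (length vs) (\<lambda>(i, j). real (d (vs ! i) (vs ! j)))) k} * sq_norm y"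
proof -
  let ?A = "Matrix.mat (length vs) (length vs) (\<lambda>(i, j). real (d (vs ! i) (vs ! j)))"
  obtain x \<mu> where x: "\<And>u. u \<in> V \<Longrightarrow> 0 < x u"
    "\<And>u. u \<in> V \<Longrightarrow> (\<Sum>w\<in>V. real (d u w) * x w) = \<mu> * x u"
    "\<And>y. dist_form d V y \<le> \<mu> * sq_norm y" "dist_form d V x = \<mu> * sq_norm x"
    by (rule perron_vector) blast
  have "V \<noteq> {}" using card_V by auto
  have "Max {k. eigenvalue ?A k} = \<mu>"
  proof (rule Max_eqI)
    have A: "?A \<in> carrier_mat (length vs) (length vs)" by simp
    have "char_poly ?A \<noteq> 0" using degree_monic_char_poly[OF A] by auto
    then show "finite {k. eigenvalue ?A k}"
      unfolding eigenvalue_root_char_poly[OF A] by (rule poly_roots_finite)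
    show "\<mu> \<in> {k. eigenvalue ?A k}"
    proof -
      obtain u where u: "u \<in> V" using \<open>V \<noteq> {}\<close> by blast
      then have "\<exists>u\<in>V. x u \<noteq> 0" using x(1)[OF u] by (intro bexI[OF _ u]) simp
      then show ?thesis using x(2) unfolding mem_Collect_eq eigenvalue_mat_iff[OF vs] by blast
    qed
  next
    fix k assume "k \<in> {k. eigenvalue ?A k}"
    then obtain y u where y: "u \<in> V" "y u \<noteq> 0" "\<And>u. u \<in> V \<Longrightarrow> (\<Sum>w\<in>V. real (d u w) * y w) = k * y u"
      unfolding mem_Collect_eq eigenvalue_mat_iff[OF vs] by blast
    have "dist_form d V y = (\<Sum>u\<in>V. y u * (\<Sum>w\<in>V. real (d u w) * y w))"
      by (simp add: dist_form_def sum_distrib_left mult_ac)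
    also have "\<dots> = (\<Sum>u\<in>V. y u * (k * y u))" by (rule sum.cong) (simp_all add: y(3))
    also have "\<dots> = k * sq_norm y" by (simp add: sq_norm_def sum_distrib_left power2_eq_square mult_ac)
    finally have "k * sq_norm y \<le> \<mu> * sq_norm y" using x(3)[of y] by simp
    moreover have "sq_norm y \<noteq> 0" using sq_norm_eq_0 y(1,2) by blast
    ultimately show "k \<le> \<mu>" using sq_norm_nonneg[of y] by simp
  qed
  then show thesis using that[of x] x by blast
qed

end

context connected_pair_graph
begin

lemma distance_form_graph_dist:
  assumes "2 \<le> card (pverts G)"
  shows "distance_form (graph_dist G) (pverts G)"
proof
  show "1 \<le> graph_dist G u v" if "u \<in> pverts G" "v \<in> pverts G" "u \<noteq> v" for u v
    using graph_dist_eq_0_iff[OF that(1,2)] that(3) by simp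
qed (use assms in \<open>simp_all add: pair_finite_verts graph_dist_self graph_dist_commute\<close>)

lemma distance_spectral_radius_rayleigh:
  assumes "2 \<le> card (pverts G)"
  obtains x where "\<And>u. u \<in> pverts G \<Longrightarrow> 0 < x u"
    "dist_form (graph_dist G) (pverts G) x = distance_spectral_radius G * (\<Sum>u\<in>pverts G. (x u)\<^sup>2)"
    "\<And>y. dist_form (graph_dist G) (pverts G) y \<le> distance_spectral_radius G * (\<Sum>u\<in>pverts G. (y u)\<^sup>2)"
proof -
  interpret D: distance_form "graph_dist G" "pverts G"
    using assms by (rule distance_form_graph_dist)
  define vs where "vs = (SOME vs. distinct vs \<and> set vs = pverts G)"
  have "\<exists>vs. distinct vs \<and> set vs = pverts G"
    using finite_distinct_list[OF pair_finite_verts] by blast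
  then have vs: "distinct vs \<and> set vs = pverts G" unfolding vs_def by (rule someI_ex)
  have rho: "distance_spectral_radius G =
      Max {k. eigenvalue (Matrix.mat (length vs) (length vs) (\<lambda>(i, j). real (graph_dist G (vs ! i) (vs ! j)))) k}"
    unfolding distance_spectral_radius_def distance_matrix_def vs_def ..
  from D.Max_eigenvalue[OF conjunct1[OF vs] conjunct2[OF vs]] show thesis
    unfolding rho[symmetric] D.sq_norm_def using that by blast
qed

end

section \<open>The kite graph\<close>

lemma pverts_kite [simp]: "pverts (kite n) = {0..<n}"
  by (simp add: kite_def)

lemma kite_dist_eq_1_iff:
  "kite_dist i j = 1 \<longleftrightarrow> i \<noteq> j \<and> (i < 4 \<and> j < 4 \<or> j = Suc i \<or> i = Suc j)"
proof -
  have "kite_dist i j = 1 \<longleftrightarrow> i \<noteq> j \<and> (i - 2 - (j - 2)) + (j - 2 - (i - 2)) \<le> 1"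
    by (auto simp: kite_dist_def max_def)
  moreover have "(i - 2 - (j - 2)) + (j - 2 - (i - 2)) \<le> 1 \<longleftrightarrow>
      i = j \<or> i < 4 \<and> j < 4 \<or> j = Suc i \<or> i = Suc j"
    by arith
  ultimately show ?thesis by blast
qed

lemma parcs_kite_iff: "(i, j) \<in> parcs (kite n) \<longleftrightarrow> i < n \<and> j < n \<and> kite_dist i j = 1"
  unfolding kite_dist_eq_1_iff by (auto simp: kite_def)

lemma pair_graph_kite: "pair_graph (kite n)"
proof
  show "finite (parcs (kite n))"
    by (rule finite_subset[of _ "{0..<n} \<times> {0..<n}"]) (auto simp: parcs_kite_iff)
  show "symmetric (with_proj (kite n))"
    unfolding symmetric_def by (rule symI) (simp add: parcs_kite_iff kite_dist_commute)
  show "fst e \<in> pverts (kite n)" "snd e \<in> pverts (kite n)" "fst e \<noteq> snd e" if "e \<in> parcs (kite n)" for e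
    using that by (cases e; auto simp: parcs_kite_iff)+
qed simp

lemma connected_kite:
  assumes "1 \<le> n"
  shows "Digraph_Component.connected (with_proj (kite n))"
proof -
  interpret pair_graph "kite n" by (rule pair_graph_kite)
  have reach: "0 \<rightarrow>\<^sup>*\<^bsub>with_proj (kite n)\<^esub> i" if "i < n" for i
    using that
  proof (induction i)
    case 0
    then show ?case by simp
  next
    case (Suc i)
    have adj: "(i, Suc i) \<in> parcs (kite n)"
      using Suc.prems kite_dist_eq_1_iff[of i "Suc i"] by (simp add: parcs_kite_iff)
    have reach: "0 \<rightarrow>\<^sup>*\<^bsub>with_proj (kite n)\<^esub> i" by (rule Suc.IH) (use Suc.prems in simp)
    show ?case by (rule reachable_adj_trans[OF reach adj])
  qed
  have "i \<rightarrow>\<^sup>*\<^bsub>with_proj (kite n)\<^esub> j" if "i < n" "j < n" for i j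
    using reachable_trans[OF symmetric_reachable[OF pair_sym_arcs reach[OF that(1)]] reach[OF that(2)]] .
  then have "i \<rightarrow>\<^sup>*\<^bsub>mk_symmetric (with_proj (kite n))\<^esub> j" if "i < n" "j < n" for i j
    using that by (simp only: reachable_mk_symmetric_eq[OF pair_sym_arcs])
  then show ?thesis
    unfolding Digraph_Component.connected_def strongly_connected_def using assms by simp
qed

lemma connected_pair_graph_kite: "1 \<le> n \<Longrightarrow> connected_pair_graph (kite n)"
  by (intro connected_pair_graph.intro connected_pair_graph_axioms.intro pair_graph_kite connected_kite)

text \<open>Residues modulo 4 differ for consecutive numbers and for any two of
  \<open>0, 1, 2, 3\<close>; these four, being pairwise adjacent, also give the lower bound.\<close>

lemma chromatic_number_kite:
  assumes "4 \<le> n"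
  shows "chromatic_number (kite n) = 4"
  unfolding chromatic_number_def
proof (rule Least_equality)
  have Suc_mod: "i mod 4 \<noteq> Suc i mod 4" for i :: nat by (simp add: mod_Suc)
  have proper: "u mod 4 \<noteq> v mod 4" if "(u, v) \<in> parcs (kite n)" for u v
  proof -
    from that consider "u \<noteq> v" "u < 4" "v < 4" | "v = Suc u" | "u = Suc v"
      by (auto simp: kite_def)
    then show ?thesis
    proof cases
      case 3
      then show ?thesis using Suc_mod[of v] by simp
    qed (use Suc_mod in simp_all)
  qed
  show "colorable (kite n) 4"
    unfolding colorable_def
  proof (intro exI[of _ "\<lambda>v. v mod 4"] conjI ballI)
    fix e assume "e \<in> parcs (kite n)"
    then show "case e of (u, v) \<Rightarrow> u mod 4 \<noteq> v mod 4" using proper by (cases e) simp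
  qed simp
next
  fix k assume "colorable (kite n) k"
  then obtain c :: "nat \<Rightarrow> nat" where c: "\<forall>v\<in>{0..<n}. c v < k" "\<forall>(u, v)\<in>parcs (kite n). c u \<noteq> c v"
    unfolding colorable_def by auto
  have "inj_on c {..<4}"
  proof (rule inj_onI, rule ccontr)
    fix i j assume ij: "i \<in> {..<4}" "j \<in> {..<4}" "c i = c j" "i \<noteq> j"
    then have "(i, j) \<in> parcs (kite n)" using assms by (simp add: kite_def)
    then show False using c(2) ij(3) by auto
  qed
  moreover have "c ` {..<4} \<subseteq> {..<k}" using c(1) assms by auto
  ultimately show "4 \<le> k" using card_inj_on_le[of c "{..<4}" "{..<k}"] by simp
qed

text \<open>The upper bound walks outwards from \<open>i\<close> one vertex at a time; the lower
  bound applies the triangle inequality for \<open>kite_dist\<close> along an arbitrary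
  walk.\<close>

lemma graph_dist_kite:
  assumes "i < n" "j < n"
  shows "graph_dist (kite n) i j = kite_dist i j"
proof -
  interpret connected_pair_graph "kite n" using assms by (intro connected_pair_graph_kite) simp
  have upper: "graph_dist (kite n) i j \<le> kite_dist i j" if "i \<le> j" "j < n" for i j
    using that
  proof (induction j)
    case 0
    then show ?case using graph_dist_self[of 0] by simp
  next
    case (Suc j)
    consider "i = Suc j" | "i \<le> j" "3 \<le> j" | "i \<le> j" "j < 3" using Suc.prems by linarith
    then show ?case
    proof cases
      case 1
      then show ?thesis using graph_dist_self[of "Suc j"] Suc.prems by simp
    next
      case 2
      have "(j, Suc j) \<in> parcs (kite n)" using Suc.prems kite_dist_eq_1_iff[of j "Suc j"] by (simp add: parcs_kite_iff)
      then have "graph_dist (kite n) i (Suc j) \<le> Suc (graph_dist (kite n) i j)"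
        using 2 Suc.prems by (intro graph_dist_Suc) simp_all
      also have "\<dots> \<le> Suc (kite_dist i j)" using Suc 2 by simp
      also have "\<dots> = kite_dist i (Suc j)" using 2 by (simp add: kite_dist_Suc_right)
      finally show ?thesis .
    next
      case 3
      then have "kite_dist i (Suc j) = 1" unfolding kite_dist_eq_1_iff by simp
      moreover from this have "(i, Suc j) \<in> parcs (kite n)" using 3 Suc.prems by (simp add: parcs_kite_iff)
      ultimately show ?thesis using graph_dist_eq_1_iff[of i "Suc j"] 3 Suc.prems by simp
    qed
  qed
  have lower: "kite_dist i j \<le> length p" if "awalk i p j" for i p
    using that
  proof (induction p arbitrary: i)
    case Nil
    then show ?case by (simp add: awalk_Nil_iff)
  next
    case (Cons e p)
    then have e: "e \<in> parcs (kite n)" "fst e = i" "awalk (snd e) p j" by (simp_all add: awalk_simps)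
    have "(i, snd e) \<in> parcs (kite n)" using e(1,2) by (cases e) simp
    then have "kite_dist i (snd e) = 1" unfolding parcs_kite_iff by blast
    moreover have "kite_dist (snd e) j \<le> length p" using e(3) by (rule Cons.IH)
    ultimately show ?case using kite_dist_triangle[of i j "snd e"] by simp
  qed
  have "graph_dist (kite n) i j \<le> kite_dist i j"
  proof (cases "i \<le> j")
    case False
    then show ?thesis
      using upper[of j i] assms graph_dist_commute[of i j] by (simp add: kite_dist_commute)
  qed (use upper assms in simp)
  moreover have "kite_dist i j \<le> graph_dist (kite n) i j"
  proof -
    obtain p where "awalk i p j" "length p = graph_dist (kite n) i j"
      using ex_awalk_length_graph_dist[of i j] assms by auto
    then show ?thesis using lower by metis
  qed
  ultimately show ?thesis by (rule order.antisym)
qed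

text \<open>Adjacency is distance 1 in both graphs, so agreement of the distances already makes the
  enumeration an isomorphism.\<close>

lemma (in connected_pair_graph) digraph_iso_kiteI:
  assumes vs: "distinct vs" "set vs = pverts G" "length vs = n"
    and dist: "\<And>i j. i < n \<Longrightarrow> j < n \<Longrightarrow> graph_dist G (vs ! i) (vs ! j) = kite_dist i j"
  shows "digraph_iso (with_proj G) (with_proj (kite n))"
proof -
  define f where "f = inv_into {..<n} ((!) vs)"
  have bij: "bij_betw ((!) vs) {..<n} (pverts G)" 
    by (rule bij_betw_nth[OF vs(1)]) (simp_all add: vs)
  have bij_f: "bij_betw f (pverts G) {..<n}" unfolding f_def using bij by (rule bij_betw_inv_into)
  have f_less: "f u < n" if "u \<in> pverts G" for u 
    using bij_betwE[OF bij_f] that unfolding lessThan_iff by blast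
  have nth_f: "vs ! f u = u" if "u \<in> pverts G" for u
    unfolding f_def using bij_betw_inv_into_right[OF bij that] .
  have f_nth: "f (vs ! i) = i" if "i < n" for i
    unfolding f_def by (rule bij_betw_inv_into_left[OF bij]) (simp add: that)
  have nth_in: "vs ! i \<in> pverts G" if "i < n" for i 
    using bij_betwE[OF bij] that unfolding Ball_def lessThan_iff by blast
  have arc: "(u, v) \<in> parcs G \<longleftrightarrow> (f u, f v) \<in> parcs (kite n)" if "u \<in> pverts G" "v \<in> pverts G" for u v
    using f_less[OF that(1)] f_less[OF that(2)]
      dist[OF f_less[OF that(1)] f_less[OF that(2)]]
    unfolding graph_dist_eq_1_iff[OF that, symmetric] parcs_kite_iff nth_f[OF that(1)] nth_f[OF that(2)]
    by (simp only: simp_thms)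
  define h where "h = \<lparr>iso_verts = f, iso_arcs = (\<lambda>(u, v). (f u, f v)), iso_head = snd, iso_tail = fst\<rparr>"
  have inj: "inj_on f (pverts G)" using bij_f by (simp add: bij_betw_def)
  have arcs_image: "(\<lambda>(u, v). (f u, f v)) ` parcs G = parcs (kite n)"
  proof (intro equalityI subsetI)
    fix e assume "e \<in> (\<lambda>(u, v). (f u, f v)) ` parcs G"
    then obtain e' where e': "e' \<in> parcs G" "e = (case e' of (u, v) \<Rightarrow> (f u, f v))" 
      unfolding image_iff by blast
    obtain u v where "e' = (u, v)" by (cases e')
    with e' have uv: "e = (f u, f v)" "(u, v) \<in> parcs G" by simp_all
    show "e \<in> parcs (kite n)"
      using arc[OF in_arcsD1[OF uv(2)] in_arcsD2[OF uv(2)]] uv by simp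
  next
    fix e assume e: "e \<in> parcs (kite n)"
    obtain i j where ij: "e = (i, j)" by (cases e)
    with e have less: "i < n" "j < n" by (simp_all add: parcs_kite_iff)
    then have "(vs ! i, vs ! j) \<in> parcs G"
      using arc[OF nth_in[OF less(1)] nth_in[OF less(2)]] e by (simp add: ij f_nth)
    then show "e \<in> (\<lambda>(u, v). (f u, f v)) ` parcs G"
      by (rule rev_image_eqI) (simp add: ij f_nth less)
  qed
  have inj_arcs: "inj_on (\<lambda>(u, v). (f u, f v)) (parcs G)"
  proof (rule inj_onI)
    fix e e' assume e: "e \<in> parcs G" "e' \<in> parcs G"
      and eq: "(case e of (u, v) \<Rightarrow> (f u, f v)) = (case e' of (u, v) \<Rightarrow> (f u, f v))"
    obtain u v u' v' where *: "e = (u, v)" "e' = (u', v')" by (cases e; cases e')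
    have f_eq: "f u = f u'" "f v = f v'" using eq by (simp_all add: *)
    have arcs: "(u, v) \<in> parcs G" "(u', v') \<in> parcs G" using e by (simp_all add: *)
    show "e = e'"
      using inj_onD[OF inj f_eq(1) in_arcsD1[OF arcs(1)] in_arcsD1[OF arcs(2)]]
        inj_onD[OF inj f_eq(2) in_arcsD2[OF arcs(1)] in_arcsD2[OF arcs(2)]] by (simp add: *)
  qed
  have h: "iso_verts h = f" "iso_arcs h = (\<lambda>(u, v). (f u, f v))" "iso_head h = snd" "iso_tail h = fst"
    by (simp_all add: h_def)
  have iso: "pre_digraph.digraph_isomorphism (with_proj G) h"
    unfolding pre_digraph.digraph_isomorphism_def h with_proj_simps
  proof (intro conjI ballI)
    show "wf_digraph (with_proj G)" by (rule wf_digraph_axioms)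
    show "inj_on f (pverts G)" by (rule inj)
    show "inj_on (\<lambda>(u, v). (f u, f v)) (parcs G)" by (rule inj_arcs)
    show "f (fst a) = fst (case a of (u, v) \<Rightarrow> (f u, f v))" for a :: "'a \<times> 'a" by (cases a) simp
    show "f (snd a) = snd (case a of (u, v) \<Rightarrow> (f u, f v))" for a :: "'a \<times> 'a" by (cases a) simp
  qed
  have "f ` pverts G = {0..<n}" using bij_f by (simp only: bij_betw_def atLeast0LessThan)
  then have "with_proj (kite n) = app_iso h (with_proj G)"
    unfolding app_iso_def h with_proj_simps arcs_image by (simp only: with_proj_def pverts_kite)
  with iso show ?thesis unfolding digraph_iso_def by (intro exI[of _ h] conjI)
qed

section \<open>A plane drawing of the kite\<close>

text \<open>
  A straight-line drawing: the vertex \<open>0\<close> lies inside the triangle \<open>1, 2, 3\<close>, and the path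
  leaves the triangle at \<open>3\<close> along the real axis.
\<close>

definition kite_point :: "nat \<Rightarrow> complex" where
  "kite_point i =
     (if i = 0 then Complex (- 1) 0 else if i = 1 then Complex (- 2) 1
      else if i = 2 then Complex (- 2) (- 1) else Complex (real i - 3) 0)"

text \<open>The closed segments of the drawing in coordinates, each edge with its smaller end first,
  so that crossings become a matter of linear arithmetic.\<close>

definition on_kite_edge :: "nat \<Rightarrow> nat \<Rightarrow> complex \<Rightarrow> bool" where
  "on_kite_edge u v z \<longleftrightarrow>
     3 \<le> u \<and> v = Suc u \<and> Im z = 0 \<and> real u - 3 \<le> Re z \<and> Re z \<le> real u - 2 \<or>
     u = 0 \<and> v = 3 \<and> Im z = 0 \<and> - 1 \<le> Re z \<and> Re z \<le> 0 \<or>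
     u = 0 \<and> v = 1 \<and> Im z = - 1 - Re z \<and> - 2 \<le> Re z \<and> Re z \<le> - 1 \<or>
     u = 0 \<and> v = 2 \<and> Im z = 1 + Re z \<and> - 2 \<le> Re z \<and> Re z \<le> - 1 \<or>
     u = 1 \<and> v = 2 \<and> Re z = - 2 \<and> - 1 \<le> Im z \<and> Im z \<le> 1 \<or>
     u = 1 \<and> v = 3 \<and> Im z = - Re z / 2 \<and> - 2 \<le> Re z \<and> Re z \<le> 0 \<or>
     u = 2 \<and> v = 3 \<and> Im z = Re z / 2 \<and> - 2 \<le> Re z \<and> Re z \<le> 0"

lemma kite_point_simps:
  "kite_point 0 = Complex (- 1) 0" "kite_point (Suc 0) = Complex (- 2) 1"
  "kite_point 2 = Complex (- 2) (- 1)" "3 \<le> i \<Longrightarrow> kite_point i = Complex (real i - 3) 0"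
  by (simp_all add: kite_point_def)

lemma kite_vertex_cases: "i = 0 \<or> i = 1 \<or> i = 2 \<or> 3 \<le> i" for i :: nat
  by linarith

lemma inj_kite_point: "inj kite_point"
proof (rule injI)
  fix i j assume "kite_point i = kite_point j"
  then show "i = j"
    using kite_vertex_cases[of i] kite_vertex_cases[of j]
    by (elim disjE) (simp_all add: kite_point_simps(1-3) kite_point_simps(4)[of i] kite_point_simps(4)[of j])
qed

lemma kite_arc_cases:
  assumes "(u, v) \<in> parcs (kite n)" "u < v"
  shows "3 \<le> u \<and> v = Suc u \<or> u = 0 \<and> v = 3 \<or> u = 0 \<and> v = 1 \<or> u = 0 \<and> v = 2 \<or>
    u = 1 \<and> v = 2 \<or> u = 1 \<and> v = 3 \<or> u = 2 \<and> v = 3"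
proof -
  have "v < 4 \<or> v = Suc u" using assms by (auto simp: kite_def)
  then show ?thesis using assms(2) by presburger
qed

lemma on_kite_edgeI:
  assumes "(u, v) \<in> parcs (kite n)" "u < v" "z \<in> closed_segment (kite_point u) (kite_point v)"
  shows "on_kite_edge u v z"
proof -
  obtain t where t: "0 \<le> t" "t \<le> 1" "z = (1 - t) *\<^sub>R kite_point u + t *\<^sub>R kite_point v"
    using assms(3) unfolding in_segment(1) by blast
  have z: "Re z = (1 - t) * Re (kite_point u) + t * Re (kite_point v)"
    "Im z = (1 - t) * Im (kite_point u) + t * Im (kite_point v)"
    by (simp_all add: t(3))
  consider (path) "3 \<le> u" "v = Suc u" | (triangle) "u = 0 \<and> v = 3 \<or> u = 0 \<and> v = 1 \<or> u = 0 \<and> v = 2 \<or>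
    u = 1 \<and> v = 2 \<or> u = 1 \<and> v = 3 \<or> u = 2 \<and> v = 3"
    using kite_arc_cases[OF assms(1,2)] by blast
  then show ?thesis
  proof cases
    case path
    have "Re z = real u - 3 + t" "Im z = 0"
      using path unfolding z by (simp_all add: kite_point_simps algebra_simps)
    with path t(1,2) show ?thesis unfolding on_kite_edge_def by (intro disjI1 conjI) simp_all
  next
    case triangle
    then show ?thesis
      using t(1,2) unfolding on_kite_edge_def z
      by (elim disjE conjE) (simp_all add: kite_point_simps kite_point_simps(4)[of 3])
  qed
qed

lemma kite_point_on_kite_edge:
  assumes "on_kite_edge u v (kite_point w)"
  shows "w = u \<or> w = v"
proof (cases "3 \<le> w")
  case True
  consider (path) "real u - 3 \<le> real w - 3" "real w - 3 \<le> real u - 2" "v = Suc u"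
    | (last) "v = 3" "real w - 3 \<le> 0" | (other) "real w - 3 \<le> - 1"
  proof -
    have "(real u - 3 \<le> real w - 3 \<and> real w - 3 \<le> real u - 2 \<and> v = Suc u) \<or>
        (v = 3 \<and> real w - 3 \<le> 0) \<or> real w - 3 \<le> - 1"
      using assms unfolding on_kite_edge_def kite_point_simps(4)[OF True] complex.sel
      by - (elim disjE conjE; ((intro disjI1 conjI; assumption) |
          (rule disjI2, rule disjI1, rule conjI; assumption) | (rule disjI2, rule disjI2, linarith)))
    then show thesis using that by blast
  qed
  then show ?thesis
  proof cases
    case path
    then have "real u \<le> real w" "real w \<le> real (Suc u)" by simp_all
    then have "u \<le> w" "w \<le> Suc u" unfolding of_nat_le_iff by blast+
    then show ?thesis using path(3) by linarith
  next
    case last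
    then have "w \<le> 3" by simp
    then show ?thesis using last(1) True by simp
  next
    case other
    then have "w \<le> 2" by simp
    then show ?thesis using True by simp
  qed
next
  case False
  then have "w = 0 \<or> w = 1 \<or> w = 2" by linarith
  then show ?thesis
    using assms unfolding on_kite_edge_def by (elim disjE conjE) (simp_all add: kite_point_simps)
qed

text \<open>All path edges are replaced by the ray on which they lie, which leaves finitely many
  pairs of lines; two path edges are excluded here and treated separately. The four points of the
  conclusion are the places of the vertices 1, 2, 0 and 3.\<close>

lemma kite_lines_meet:
  fixes x y :: real and u v u' v' :: nat
  assumes "3 \<le> u \<and> y = 0 \<and> 0 \<le> x \<or>
     u = 0 \<and> v = 3 \<and> y = 0 \<and> - 1 \<le> x \<and> x \<le> 0 \<or>
     u = 0 \<and> v = 1 \<and> y = - 1 - x \<and> - 2 \<le> x \<and> x \<le> - 1 \<or>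
     u = 0 \<and> v = 2 \<and> y = 1 + x \<and> - 2 \<le> x \<and> x \<le> - 1 \<or>
     u = 1 \<and> v = 2 \<and> x = - 2 \<and> - 1 \<le> y \<and> y \<le> 1 \<or>
     u = 1 \<and> v = 3 \<and> y = - x / 2 \<and> - 2 \<le> x \<and> x \<le> 0 \<or>
     u = 2 \<and> v = 3 \<and> y = x / 2 \<and> - 2 \<le> x \<and> x \<le> 0"
  and "3 \<le> u' \<and> y = 0 \<and> 0 \<le> x \<or>
     u' = 0 \<and> v' = 3 \<and> y = 0 \<and> - 1 \<le> x \<and> x \<le> 0 \<or>
     u' = 0 \<and> v' = 1 \<and> y = - 1 - x \<and> - 2 \<le> x \<and> x \<le> - 1 \<or>
     u' = 0 \<and> v' = 2 \<and> y = 1 + x \<and> - 2 \<le> x \<and> x \<le> - 1 \<or>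
     u' = 1 \<and> v' = 2 \<and> x = - 2 \<and> - 1 \<le> y \<and> y \<le> 1 \<or>
     u' = 1 \<and> v' = 3 \<and> y = - x / 2 \<and> - 2 \<le> x \<and> x \<le> 0 \<or>
     u' = 2 \<and> v' = 3 \<and> y = x / 2 \<and> - 2 \<le> x \<and> x \<le> 0"
  and "(u, v) \<noteq> (u', v')" "\<not> (3 \<le> u \<and> 3 \<le> u')"
  shows "x = - 2 \<and> y = 1 \<or> x = - 2 \<and> y = - 1 \<or> x = - 1 \<and> y = 0 \<or> x = 0 \<and> y = 0"
proof (rule ccontr)
  assume "\<not> ?thesis"
  then have n: "x = - 2 \<longrightarrow> y \<noteq> 1 \<and> y \<noteq> - 1" "y = 0 \<longrightarrow> x \<noteq> - 1 \<and> x \<noteq> 0" by auto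
  show False
    using assms
    by (elim disjE conjE) (use n in \<open>(simp; fail | linarith | argo)+\<close>)
qed

lemma on_kite_edge_line:
  assumes "on_kite_edge u v z"
  shows "3 \<le> u \<and> Im z = 0 \<and> 0 \<le> Re z \<or>
     u = 0 \<and> v = 3 \<and> Im z = 0 \<and> - 1 \<le> Re z \<and> Re z \<le> 0 \<or>
     u = 0 \<and> v = 1 \<and> Im z = - 1 - Re z \<and> - 2 \<le> Re z \<and> Re z \<le> - 1 \<or>
     u = 0 \<and> v = 2 \<and> Im z = 1 + Re z \<and> - 2 \<le> Re z \<and> Re z \<le> - 1 \<or>
     u = 1 \<and> v = 2 \<and> Re z = - 2 \<and> - 1 \<le> Im z \<and> Im z \<le> 1 \<or>
     u = 1 \<and> v = 3 \<and> Im z = - Re z / 2 \<and> - 2 \<le> Re z \<and> Re z \<le> 0 \<or>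
     u = 2 \<and> v = 3 \<and> Im z = Re z / 2 \<and> - 2 \<le> Re z \<and> Re z \<le> 0"
proof (cases "3 \<le> u \<and> v = Suc u \<and> Im z = 0 \<and> real u - 3 \<le> Re z \<and> Re z \<le> real u - 2")
  case True
  then have "3 \<le> real u" by simp
  then have "0 \<le> Re z" using True by linarith
  with True show ?thesis by (intro disjI1 conjI) simp_all
next
  case False
  from assms[unfolded on_kite_edge_def] show ?thesis
  proof (rule disjE)
    assume "3 \<le> u \<and> v = Suc u \<and> Im z = 0 \<and> real u - 3 \<le> Re z \<and> Re z \<le> real u - 2"
    with False show ?thesis by (rule notE)
  qed (rule disjI2)
qed

lemma kite_edges_meet:
  assumes "on_kite_edge u v z" "on_kite_edge u' v' z" "(u, v) \<noteq> (u', v')"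
  shows "z \<in> range kite_point"
proof (cases "3 \<le> u \<and> 3 \<le> u'")
  case True
  then have *: "v = Suc u" "v' = Suc u'" "Im z = 0" "real u - 3 \<le> Re z" "Re z \<le> real u - 2"
    "real u' - 3 \<le> Re z" "Re z \<le> real u' - 2"
    using assms(1,2) by (auto simp: on_kite_edge_def)
  then consider "Suc u \<le> u'" | "Suc u' \<le> u" using assms(3) by fastforce
  then show ?thesis
  proof cases
    case 1
    then have "real u + 1 \<le> real u'" by simp
    then have "z = kite_point u'" using * True by (simp add: kite_point_def complex_eq_iff)
    then show ?thesis by simp
  next
    case 2
    then have "real u' + 1 \<le> real u" by simp
    then have "z = kite_point u" using * True by (simp add: kite_point_def complex_eq_iff)
    then show ?thesis by simp
  qed
next
  case False
  have "Re z = - 2 \<and> Im z = 1 \<or> Re z = - 2 \<and> Im z = - 1 \<or> Re z = - 1 \<and> Im z = 0 \<or> Re z = 0 \<and> Im z = 0"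
    by (rule kite_lines_meet[OF on_kite_edge_line[OF assms(1)] on_kite_edge_line[OF assms(2)] assms(3) False])
  then have "z = kite_point 1 \<or> z = kite_point 2 \<or> z = kite_point 0 \<or> z = kite_point 3"
    by (simp add: kite_point_def complex_eq_iff)
  then show ?thesis by (elim disjE) simp_all
qed

lemma planar_kite: "planar (kite n)"
proof -
  \<comment> \<open>An edge arrives as an unordered set; \<open>Min\<close> and \<open>Max\<close>
    fix a direction for its segment.\<close>
  define g where "g s = linepath (kite_point (Min s)) (kite_point (Max s))" for s
  have arc_facts: "arc (g {u, v}) \<and> {pathstart (g {u, v}), pathfinish (g {u, v})} = {kite_point u, kite_point v} \<and>
      path_image (g {u, v}) \<inter> kite_point ` {0..<n} = {kite_point u, kite_point v}"
    "\<And>z. z \<in> path_image (g {u, v}) \<Longrightarrow> on_kite_edge u v z"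
    if uv: "(u, v) \<in> parcs (kite n)" "u < v" for u v
  proof -
    have g: "g {u, v} = linepath (kite_point u) (kite_point v)"
      using uv(2) by (simp add: g_def)
    have "u < n" "v < n" using uv(1) by (simp_all add: parcs_kite_iff)
    show on: "on_kite_edge u v z" if "z \<in> path_image (g {u, v})" for z
      using on_kite_edgeI[OF uv] that by (simp add: g)
    have "arc (g {u, v})" using inj_kite_point uv(2) by (simp add: g inj_eq arc_linepath)
    moreover have "path_image (g {u, v}) \<inter> kite_point ` {0..<n} = {kite_point u, kite_point v}"
    proof (intro equalityI subsetI)
      fix z assume z: "z \<in> path_image (g {u, v}) \<inter> kite_point ` {0..<n}"
      then obtain w where w: "z = kite_point w" by blast
      have "on_kite_edge u v (kite_point w)" using on z w by simp
      then have "w = u \<or> w = v" by (rule kite_point_on_kite_edge)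
      then show "z \<in> {kite_point u, kite_point v}" by (elim disjE) (simp_all add: w)
    next
      fix z assume "z \<in> {kite_point u, kite_point v}"
      then show "z \<in> path_image (g {u, v}) \<inter> kite_point ` {0..<n}"
        using \<open>u < n\<close> \<open>v < n\<close> by (elim insertE emptyE) (simp_all add: g)
    qed
    moreover have "{pathstart (g {u, v}), pathfinish (g {u, v})} = {kite_point u, kite_point v}"
      by (simp add: g)
    ultimately show "arc (g {u, v}) \<and> {pathstart (g {u, v}), pathfinish (g {u, v})} = {kite_point u, kite_point v} \<and>
        path_image (g {u, v}) \<inter> kite_point ` {0..<n} = {kite_point u, kite_point v}"
      by (intro conjI)
  qed
  have sorted: "\<exists>a b. {u, v} = {a, b} \<and> a < b \<and> (a, b) \<in> parcs (kite n)"
    if "(u, v) \<in> parcs (kite n)" for u v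
  proof (cases "u < v")
    case False
    moreover have "u \<noteq> v" using that by (auto simp: parcs_kite_iff)
    ultimately have "v < u" "(v, u) \<in> parcs (kite n)"
      using that by (auto simp: parcs_kite_iff kite_dist_commute)
    then show ?thesis by (intro exI[of _ v] exI[of _ u]) (simp add: insert_commute)
  qed (use that in \<open>intro exI[of _ u] exI[of _ v], simp\<close>)
  have 1: "arc (g {u, v}) \<and> {pathstart (g {u, v}), pathfinish (g {u, v})} = {kite_point u, kite_point v} \<and>
      path_image (g {u, v}) \<inter> kite_point ` {0..<n} = {kite_point u, kite_point v}"
    if uv: "(u, v) \<in> parcs (kite n)" for u v
  proof -
    obtain a b where ab: "{u, v} = {a, b}" "a < b" "(a, b) \<in> parcs (kite n)" using sorted[OF uv] by blast
    have "{kite_point u, kite_point v} = kite_point ` {u, v}" by simp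
    also have "\<dots> = {kite_point a, kite_point b}" by (simp add: ab(1))
    finally show ?thesis using arc_facts(1)[OF ab(3,2)] by (simp only: ab(1))
  qed
  have 2: "path_image (g {u, v}) \<inter> path_image (g {x, y}) \<subseteq> kite_point ` {0..<n}"
    if uv: "(u, v) \<in> parcs (kite n)" and xy: "(x, y) \<in> parcs (kite n)" and ne: "{u, v} \<noteq> {x, y}" for u v x y
  proof
    fix z assume z: "z \<in> path_image (g {u, v}) \<inter> path_image (g {x, y})"
    obtain a b where ab: "{u, v} = {a, b}" "a < b" "(a, b) \<in> parcs (kite n)" using sorted[OF uv] by blast
    obtain a' b' where ab': "{x, y} = {a', b'}" "a' < b'" "(a', b') \<in> parcs (kite n)" using sorted[OF xy] by blast
    have "on_kite_edge a b z" using arc_facts(2)[OF ab(3,2)] z by (simp add: ab(1))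
    moreover have "on_kite_edge a' b' z" using arc_facts(2)[OF ab'(3,2)] z by (simp add: ab'(1))
    moreover have "(a, b) \<noteq> (a', b')" using ne ab(1) ab'(1) by auto
    ultimately have "z \<in> range kite_point" by (rule kite_edges_meet)
    then obtain w where w: "z = kite_point w" by (elim rangeE)
    with \<open>on_kite_edge a b z\<close> have "w = a \<or> w = b" by (intro kite_point_on_kite_edge) simp
    moreover have "a < n" "b < n" using ab(3) by (simp_all add: parcs_kite_iff)
    ultimately have "w < n" by (elim disjE) simp_all
    then show "z \<in> kite_point ` {0..<n}" by (intro rev_image_eqI[of w]) (simp_all add: w)
  qed
  have "plane_drawing (kite n) kite_point g"
    unfolding plane_drawing_def pverts_kite
  proof (intro conjI ballI)
    show "inj_on kite_point {0..<n}" by (rule inj_on_subset[OF inj_kite_point subset_UNIV])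
    fix e assume e: "e \<in> parcs (kite n)"
    obtain u v where uv: "e = (u, v)" by (cases e)
    show "case e of (u, v) \<Rightarrow> arc (g {u, v}) \<and>
        {pathstart (g {u, v}), pathfinish (g {u, v})} = {kite_point u, kite_point v} \<and>
        path_image (g {u, v}) \<inter> kite_point ` {0..<n} = {kite_point u, kite_point v}"
      using 1[OF e[unfolded uv]] by (simp only: uv prod.case)
    show "case e of (u, v) \<Rightarrow> \<forall>(x, y)\<in>parcs (kite n). {u, v} \<noteq> {x, y} \<longrightarrow>
        path_image (g {u, v}) \<inter> path_image (g {x, y}) \<subseteq> kite_point ` {0..<n}"
      unfolding uv prod.case
    proof (intro ballI)
      fix e' assume e': "e' \<in> parcs (kite n)"
      obtain x y where xy: "e' = (x, y)" by (cases e')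
      show "case e' of (x, y) \<Rightarrow> {u, v} \<noteq> {x, y} \<longrightarrow>
          path_image (g {u, v}) \<inter> path_image (g {x, y}) \<subseteq> kite_point ` {0..<n}"
        unfolding xy prod.case using 2[OF e[unfolded uv] e'[unfolded xy]] by (intro impI)
    qed
  qed
  then show ?thesis unfolding planar_def by blast
qed

section \<open>Comparison with the kite\<close>

lemma kite_form_eq_dist_form:
  assumes "length ws = n"
  shows "kite_form ws = dist_form (graph_dist (kite n)) {0..<n} (\<lambda>i. ws ! i)"
  unfolding kite_form_def dist_form_def assms atLeast0LessThan
  by (intro sum.cong refl) (simp add: graph_dist_kite)

text \<open>Naming the vertices of the kite by \<open>vs\<close> only permutes the weights, so the
  squared norm is unchanged and the Rayleigh bound of the kite applies to \<open>x\<close>.\<close>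

lemma kite_form_le_distance_spectral_radius:
  assumes n: "4 \<le> n" and vs: "distinct vs" "set vs = V" "length vs = n"
  shows "kite_form (map x vs) \<le> distance_spectral_radius (kite n) * (\<Sum>u\<in>V. (x u)\<^sup>2)"
proof -
  interpret K: connected_pair_graph "kite n"
    using n by (intro connected_pair_graph_kite) simp
  have "kite_form (map x vs) = dist_form (graph_dist (kite n)) {0..<n} (\<lambda>i. map x vs ! i)"
    using vs(3) by (intro kite_form_eq_dist_form) simp
  also have "\<dots> \<le> distance_spectral_radius (kite n) * (\<Sum>i\<in>{0..<n}. (map x vs ! i)\<^sup>2)"
  proof -
    have "2 \<le> card (pverts (kite n))" using n by simp
    then show ?thesis
      using K.distance_spectral_radius_rayleigh unfolding pverts_kite by metis
  qed
  also have "(\<Sum>i\<in>{0..<n}. (map x vs ! i)\<^sup>2) = (\<Sum>i<n. (x (vs ! i))\<^sup>2)"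
    unfolding atLeast0LessThan using vs(3) by (intro sum.cong) simp_all
  also have "\<dots> = (\<Sum>u\<in>V. (x u)\<^sup>2)"
    by (rule sum.reindex_bij_betw, rule bij_betw_nth[OF vs(1)]) (simp_all add: vs)
  finally show ?thesis .
qed

lemma (in connected_pair_graph) distance_spectral_radius_less_kite:
  assumes n: "card (pverts G) = n" "4 \<le> n" and "\<not> colorable G 3"
    and not_iso: "\<not> digraph_iso (with_proj G) (with_proj (kite n))"
  shows "distance_spectral_radius G < distance_spectral_radius (kite n)"
proof -
  have "2 \<le> card (pverts G)" using n by simp
  then obtain x where pos: "\<And>u. u \<in> pverts G \<Longrightarrow> 0 < x u"
    and x: "dist_form (graph_dist G) (pverts G) x =
      distance_spectral_radius G * (\<Sum>u\<in>pverts G. (x u)\<^sup>2)"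
    by (rule distance_spectral_radius_rayleigh) blast
  have "\<forall>u\<in>pverts G. 0 < x u" using pos by blast
  with kite_dominated_if_not_3_colorable[OF assms(3)]
  obtain vs where vs: "distinct vs" "set vs = pverts G" and
    dom: "dist_form (graph_dist G) (pverts G) x < kite_form (map x vs) \<or>
      dist_form (graph_dist G) (pverts G) x \<le> kite_form (map x vs) \<and>
      (\<forall>i<length vs. \<forall>j<length vs. graph_dist G (vs ! i) (vs ! j) = kite_dist i j)"
    unfolding kite_dominated_def by blast
  have len: "length vs = n" using distinct_card[OF vs(1)] vs(2) n(1) by simp
  have "dist_form (graph_dist G) (pverts G) x < kite_form (map x vs)"
    using dom
  proof (rule disjE)
    assume "dist_form (graph_dist G) (pverts G) x \<le> kite_form (map x vs) \<and>
      (\<forall>i<length vs. \<forall>j<length vs. graph_dist G (vs ! i) (vs ! j) = kite_dist i j)"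
    then have "graph_dist G (vs ! i) (vs ! j) = kite_dist i j" if "i < n" "j < n" for i j
      using that len by simp
    then have "digraph_iso (with_proj G) (with_proj (kite n))"
      by (rule digraph_iso_kiteI[OF vs len])
    with not_iso show ?thesis by (rule notE)
  qed
  also have "\<dots> \<le> distance_spectral_radius (kite n) * (\<Sum>u\<in>pverts G. (x u)\<^sup>2)"
    by (rule kite_form_le_distance_spectral_radius[OF n(2) vs len])
  finally have less: "distance_spectral_radius G * (\<Sum>u\<in>pverts G. (x u)\<^sup>2) <
      distance_spectral_radius (kite n) * (\<Sum>u\<in>pverts G. (x u)\<^sup>2)"
    unfolding x .
  have "0 \<le> (\<Sum>u\<in>pverts G. (x u)\<^sup>2)" by (intro sum_nonneg) simp
  with less show ?thesis by (rule mult_right_less_imp_less)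
qed

theorem theorem1p1:
  fixes n :: nat
  assumes "n \<ge> 4"
  shows "connected_4chromatic_planar n (kite n) \<and>
    (\<forall>G :: 'a pair_pre_digraph.
       connected_4chromatic_planar n G \<and> \<not> digraph_iso (with_proj G) (with_proj (kite n)) \<longrightarrow>
       distance_spectral_radius G < distance_spectral_radius (kite n))"
proof (intro conjI allI impI)
  show "connected_4chromatic_planar n (kite n)"
    unfolding connected_4chromatic_planar_def
    using assms by (simp add: pair_graph_kite connected_kite chromatic_number_kite planar_kite)
next
  fix G :: "'a pair_pre_digraph"
  assume "connected_4chromatic_planar n G \<and> \<not> digraph_iso (with_proj G) (with_proj (kite n))"
  then have G: "pair_graph G" "card (pverts G) = n" "Digraph_Component.connected (with_proj G)"
    "chromatic_number G = 4" and not_iso: "\<not> digraph_iso (with_proj G) (with_proj (kite n))"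
    unfolding connected_4chromatic_planar_def by simp_all
  interpret connected_pair_graph G
    using G(1,3) by (intro connected_pair_graph.intro connected_pair_graph_axioms.intro)
  have "\<not> colorable G 3"
    by (rule not_less_Least) (simp add: G(4)[unfolded chromatic_number_def])
  then show "distance_spectral_radius G < distance_spectral_radius (kite n)"
    using distance_spectral_radius_less_kite G(2) assms not_iso by blast
qed

end
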